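(* Let $\mathbf{C}_3$ be a cycle poset with underlying crown $\mathscr{C}_3$, let $\mathcal{T}=\{(\mathbf{T}_v,r_v)\mid v\in\mathbf{C}_3\}$ be a family of rooted tree posets indexed by $\mathbf{C}_3$, and let $P$ be the unicycle poset obtained as the grafting of $\mathcal{T}$ on $\mathbf{C}_3$. Then the following three linear orders form a realizer of $P$: $$I_{z_1}^-\, I_{x_2}^-\, A_1(X_1^-)\, X_2^+\, B_2(Z_1^+)\, C_{6}\, C_{3}\, A_4(X_3^-)\, Z_2^-\, I_{z_2}^+\, B_{5}(Z_3^\bullet)\, I_{x_3}^+\, I_{x_1}^+,$$ $$I_{z_2}^-\, A_3(X_2^\bullet)\, I_{x_3}^-\, X_{3}^+\, B_4(Z_2^+)\, C_2\, C_{5}\, A_{6}(X_1^\bullet)\, Z_3^-\, B_1(Z_1^\bullet)\, I_{z_3}^+,$$ $$I_{z_3}^-\, I_{x_1}^-\, X_1^+\, A_{5}(X_3^\bullet)\, B_{6}(Z_3^+)\, C_1\, C_4\, A_2(X_2^-)\, B_3(Z_2^\bullet)\, Z_1^-\, I_{z_1}^+\, I_{x_2}^+.$$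
   Context: All posets are finite. Linear orders on a finite set are written as words, listing elements from smallest to largest; juxtaposition is concatenation. $\prod^{\nearrow}_{a\le i\le b}w_i=w_aw_{a+1}\cdots w_b$ and $\prod^{\searrow}_{a\le i\le b}w_i=w_bw_{b-1}\cdots w_a$, both being the empty word if $b<a$. A realizer of a poset $P$ is a list of linear extensions of $P$ (repetitions allowed) such that $u\le v$ in $P$ if and only if $u\le v$ in each of them. The cover graph of a poset is its undirected Hasse diagram; a tree poset is a poset whose cover graph is a tree; a rooted tree poset is a pair $(\mathbf{T},r)$ with $\mathbf{T}$ a tree poset and $r\in\mathbf{T}$. Tree notation. Let $\mathbf{T}$ be a tree poset and $w\in\mathbf{T}$. Each $t\ne w$ is joined to $w$ by a unique path in the cover graph. $\mathbf{U}_w$ (resp. $\mathbf{D}_w$) is the set of $t\in\mathbf{T}\setminus\{w\}$ for which the path from $w$ to $t$ starts with a step to an element greater (resp. smaller) than $w$. Put $\mathbf{U}_w^+=\{t\in\mathbf{U}_w: t>w\}$, $\mathbf{U}_w^-=\mathbf{U}_w\setminus\mathbf{U}_w^+$, $\mathbf{D}_w^-=\{t\in\mathbf{D}_w: t<w\}$, $\mathbf{D}_w^+=\mathbf{D}_w\setminus\mathbf{D}_w^-$. Admissible words at $w$ in $\mathbf{T}$ are: linear extensions $U_w^-,U_w^+$ of $\mathbf{U}_w^-,\mathbf{U}_w^+$ and $U_{w,1},U_{w,2}$ of $\mathbf{U}_w$ such that $U_w^-\,w\,U_w^+$, $w\,U_{w,1}$, $w\,U_{w,2}$ form a realizer of $\mathbf{U}_w\cup\{w\}$;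 and linear extensions $D_w^-,D_w^+$ of $\mathbf{D}_w^-,\mathbf{D}_w^+$ and $D_{w,1},D_{w,2}$ of $\mathbf{D}_w$ such that $D_w^-\,w\,D_w^+$, $D_{w,1}\,w$, $D_{w,2}\,w$ form a realizer of $\mathbf{D}_w\cup\{w\}$. (Admissible words always exist.) Cycle posets. The crown $\mathscr{C}_3$ has elements $x_1,x_2,x_3,z_1,z_2,z_3$ and strict relations exactly $x_{i+1}<z_i$ and $x_{i+1}<z_{i+1}$, for all $i$, indices taken cyclically mod $3$. A cycle poset $\mathbf{C}_3$ with underlying crown $\mathscr{C}_3$ is obtained by replacing, for each $p\in\{1,\dots,6\}$, the cover $x_{\lfloor p/2\rfloor+1}\lessdot z_{\lceil p/2\rceil}$ by a saturated chain $x_{\lfloor p/2\rfloor+1}\lessdot y^p_1\lessdot\cdots\lessdot y^p_{k_p}\lessdot z_{\lceil p/2\rceil}$ with $k_p\ge0$ new elements. Grafting. Given a family $\{(\mathbf{T}_v,r_v)\mid v\in Q\}$ of rooted tree posets indexed by a poset $Q$, the grafting on $Q$ is the poset on $\{(v,t): v\in Q, t\in\mathbf{T}_v\}$ with $(a,b)\le(c,d)$ iff either $a=c$ and $b\le d$ in $\mathbf{T}_a$, or $a<c$ in $Q$, $b\le r_a$ in $\mathbf{T}_a$ and $r_c\le d$ in $\mathbf{T}_c$. We identify $v$ with $(v,r_v)$ and $\mathbf{T}_v$ with $\{v\}\times\mathbf{T}_v$, so that $v$ is the root of $\mathbf{T}_v$. Words. For every $v\in\mathbf{C}_3$ fix admissible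 words at $v$ in $\mathbf{T}_v$. For $w\in\{x_i,z_i\}$ put $I_w^-=U_w^-\,D_{w,1}$ and $I_w^+=U_{w,1}\,D_w^+$; put $X_i^+=x_i\,U_{x_i}^+$, $X_i^-=D_{x_i}^-\,x_i$, $X_i^\bullet=D_{x_i,2}\,x_i\,U_{x_i,2}$, and likewise $Z_i^+=z_i\,U_{z_i}^+$, $Z_i^-=D_{z_i}^-\,z_i$, $Z_i^\bullet=D_{z_i,2}\,z_i\,U_{z_i,2}$. For $p\in\{1,\dots,6\}$ and any word $X$ put $$A_p(X)=\prod^{\searrow}_{1\le j\le k_p}\big(U_{y_j^p}^-\,D_{y_j^p,1}\big)\;X\;\prod^{\nearrow}_{1\le j\le k_p}\big(y_j^p\,U_{y_j^p}^+\big),$$ $$B_p(X)=\prod^{\nearrow}_{1\le j\le k_p}\big(D_{y_j^p}^-\,y_j^p\big)\;X\;\prod^{\searrow}_{1\le j\le k_p}\big(U_{y_j^p,1}\,D_{y_j^p}^+\big),$$ $$C_p=\prod^{\nearrow}_{1\le j\le k_p}\big(D_{y_j^p,2}\,y_j^p\,U_{y_j^p,2}\big).$$ *)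

theory Defs
  imports Main
begin

text \<open>A poset is given by its reflexive order relation \<open>P\<close>; its ground set is \<open>Field P\<close>, and the
  subposet induced on \<open>S\<close> is \<open>Restr P S\<close>.\<close>

definition finite_poset :: "'a rel \<Rightarrow> bool" where
  "finite_poset P \<longleftrightarrow> finite (Field P) \<and> Partial_order P"

text \<open>The order denoted by a word listing its elements from smallest to largest; it is a linear
  order when the word has no repeated entries.\<close>

definition word_order :: "'a list \<Rightarrow> 'a rel" where
  "word_order xs = {(xs ! i, xs ! j) | i j. i \<le> j \<and> j < length xs}"

definition linear_extension :: "'a rel \<Rightarrow> 'a list \<Rightarrow> bool" where
  "linear_extension P xs \<longleftrightarrow> distinct xs \<and> set xs = Field P \<and> P \<subseteq> word_order xs"

definition realizer :: "'a rel \<Rightarrow> 'a list list \<Rightarrow> bool" where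
  "realizer P Ls \<longleftrightarrow>
     (\<forall>L\<in>set Ls. linear_extension P L) \<and>
     (\<forall>u\<in>Field P. \<forall>v\<in>Field P. (u, v) \<in> P \<longleftrightarrow> (\<forall>L\<in>set Ls. (u, v) \<in> word_order L))"

definition covers :: "'a rel \<Rightarrow> 'a rel" where
  "covers P = {(a, b) \<in> P. a \<noteq> b \<and> \<not> (\<exists>c. c \<noteq> a \<and> c \<noteq> b \<and> (a, c) \<in> P \<and> (c, b) \<in> P)}"

text \<open>Undirected graphs are symmetric adjacency relations.\<close>

definition cover_graph :: "'a rel \<Rightarrow> 'a rel" where
  "cover_graph P = covers P \<union> (covers P)\<inverse>"

definition graph_path :: "'a rel \<Rightarrow> 'a list \<Rightarrow> bool" where
  "graph_path E p \<longleftrightarrow> p \<noteq> [] \<and> distinct p \<and> successively (\<lambda>a b. (a, b) \<in> E) p"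

definition graph_cycle :: "'a rel \<Rightarrow> 'a list \<Rightarrow> bool" where
  "graph_cycle E c \<longleftrightarrow> 3 \<le> length c \<and> graph_path E c \<and> (last c, hd c) \<in> E"

definition is_tree :: "'a set \<Rightarrow> 'a rel \<Rightarrow> bool" where
  "is_tree V E \<longleftrightarrow>
     V \<noteq> {} \<and>
     (\<forall>u\<in>V. \<forall>v\<in>V. \<exists>p. graph_path E p \<and> hd p = u \<and> last p = v) \<and>
     \<not> (\<exists>c. graph_cycle E c)"

definition tree_poset :: "'a rel \<Rightarrow> bool" where
  "tree_poset T \<longleftrightarrow> finite_poset T \<and> is_tree (Field T) (cover_graph T)"

definition rooted_tree_poset :: "'a rel \<Rightarrow> 'a \<Rightarrow> bool" where
  "rooted_tree_poset T r \<longleftrightarrow> tree_poset T \<and> r \<in> Field T"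

text \<open>In the next two definitions \<open>w # s # q\<close> is the path from \<open>w\<close> to \<open>t\<close>, which is unique in a
  tree.\<close>

definition U_set :: "'a rel \<Rightarrow> 'a \<Rightarrow> 'a set" where
  "U_set T w = {t \<in> Field T - {w}.
     \<exists>s q. graph_path (cover_graph T) (w # s # q) \<and> last (w # s # q) = t \<and> (w, s) \<in> T}"

definition D_set :: "'a rel \<Rightarrow> 'a \<Rightarrow> 'a set" where
  "D_set T w = {t \<in> Field T - {w}.
     \<exists>s q. graph_path (cover_graph T) (w # s # q) \<and> last (w # s # q) = t \<and> (s, w) \<in> T}"

definition U_pos_set :: "'a rel \<Rightarrow> 'a \<Rightarrow> 'a set" where
  "U_pos_set T w = {t \<in> U_set T w. (w, t) \<in> T}"

definition U_neg_set :: "'a rel \<Rightarrow> 'a \<Rightarrow> 'a set" where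
  "U_neg_set T w = U_set T w - U_pos_set T w"

definition D_neg_set :: "'a rel \<Rightarrow> 'a \<Rightarrow> 'a set" where
  "D_neg_set T w = {t \<in> D_set T w. (t, w) \<in> T}"

definition D_pos_set :: "'a rel \<Rightarrow> 'a \<Rightarrow> 'a set" where
  "D_pos_set T w = D_set T w - D_neg_set T w"

text \<open>The fields are, in order, $U_w^-, U_w^+, U_{w,1}, U_{w,2}, D_w^-, D_w^+, D_{w,1}, D_{w,2}$.\<close>

datatype 'a tree_words = Tree_Words
  (U_neg: "'a list") (U_pos: "'a list") (U_one: "'a list") (U_two: "'a list")
  (D_neg: "'a list") (D_pos: "'a list") (D_one: "'a list") (D_two: "'a list")

definition admissible_words :: "'a rel \<Rightarrow> 'a \<Rightarrow> 'a tree_words \<Rightarrow> bool" where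
  "admissible_words T w A \<longleftrightarrow>
     linear_extension (Restr T (U_neg_set T w)) (U_neg A) \<and>
     linear_extension (Restr T (U_pos_set T w)) (U_pos A) \<and>
     linear_extension (Restr T (U_set T w)) (U_one A) \<and>
     linear_extension (Restr T (U_set T w)) (U_two A) \<and>
     realizer (Restr T (U_set T w \<union> {w}))
       [U_neg A @ [w] @ U_pos A, [w] @ U_one A, [w] @ U_two A] \<and>
     linear_extension (Restr T (D_neg_set T w)) (D_neg A) \<and>
     linear_extension (Restr T (D_pos_set T w)) (D_pos A) \<and>
     linear_extension (Restr T (D_set T w)) (D_one A) \<and>
     linear_extension (Restr T (D_set T w)) (D_two A) \<and>
     realizer (Restr T (D_set T w \<union> {w}))
       [D_neg A @ [w] @ D_pos A, D_one A @ [w], D_two A @ [w]]"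

text \<open>\<open>X i\<close> and \<open>Z i\<close> are used for \<open>1 \<le> i \<le> 3\<close>, and \<open>Y p j\<close> is the \<open>j\<close>-th new element on the
  \<open>p\<close>-th chain, with \<open>1 \<le> p \<le> 6\<close> and \<open>1 \<le> j \<le> k p\<close>.\<close>

datatype cycle_elem = X nat | Y nat nat | Z nat

text \<open>Cyclic reduction of a positive index to \<open>{1, 2, 3}\<close>.\<close>

definition cyc :: "nat \<Rightarrow> nat" where
  "cyc i = (i - 1) mod 3 + 1"

definition crown3 :: "cycle_elem rel" where
  "crown3 = Id_on (X ` {1..3} \<union> Z ` {1..3}) \<union>
     (\<Union>i\<in>{1..3}. {(X (cyc (i + 1)), Z i), (X (cyc (i + 1)), Z (cyc (i + 1)))})"

definition cycle_carrier :: "(nat \<Rightarrow> nat) \<Rightarrow> cycle_elem set" where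
  "cycle_carrier k = X ` {1..3} \<union> Z ` {1..3} \<union> {Y p j | p j. p \<in> {1..6} \<and> j \<in> {1..k p}}"

text \<open>The indices $\lfloor p/2\rfloor+1$ and $\lceil p/2\rceil$ of the endpoints appear as
  \<open>p div 2 + 1\<close> and \<open>(p + 1) div 2\<close>.\<close>

definition cycle_chain :: "(nat \<Rightarrow> nat) \<Rightarrow> nat \<Rightarrow> cycle_elem list" where
  "cycle_chain k p =
     [X (cyc (p div 2 + 1))] @ map (Y p) [1..<Suc (k p)] @ [Z (cyc ((p + 1) div 2))]"

definition cycle_covers :: "(nat \<Rightarrow> nat) \<Rightarrow> cycle_elem rel" where
  "cycle_covers k = (\<Union>p\<in>{1..6}.
     {(cycle_chain k p ! i, cycle_chain k p ! Suc i) | i. Suc i < length (cycle_chain k p)})"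

definition cycle_poset :: "(nat \<Rightarrow> nat) \<Rightarrow> cycle_elem rel" where
  "cycle_poset k = Restr ((cycle_covers k)\<^sup>*) (cycle_carrier k)"

lemma Field_cycle_poset: "Field (cycle_poset k) = cycle_carrier k"
  by (auto simp: cycle_poset_def Field_def)

text \<open>Without new elements the cycle poset is the crown itself.\<close>

lemma cycle_poset_0: "cycle_poset (\<lambda>_. 0) = crown3"
proof -
  define R where "R = {(X 1, Z 1), (X 2, Z 1), (X 2, Z 2), (X 3, Z 2), (X 3, Z 3), (X 1, Z 3)}"
  have idx: "{1..6::nat} = {1, 2, 3, 4, 5, 6}" "{1..3::nat} = {1, 2, 3}"
    by (simp_all add: numeral_eq_Suc atLeastAtMostSuc_conv insert_commute)
  have cyc: "cyc (Suc 0) = Suc 0" "cyc (Suc (Suc 0)) = 2" "cyc 2 = 2" "cyc 3 = 3" "cyc 4 = Suc 0"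
    by (simp_all add: cyc_def)
  have chain: "{(cycle_chain (\<lambda>_. 0) p ! i, cycle_chain (\<lambda>_. 0) p ! Suc i) | i.
      Suc i < length (cycle_chain (\<lambda>_. 0) p)} =
    {(X (cyc (p div 2 + 1)), Z (cyc ((p + 1) div 2)))}" for p
    by (auto simp: cycle_chain_def)
  have covers: "cycle_covers (\<lambda>_. 0) = R"
    unfolding cycle_covers_def chain idx R_def by (simp add: cyc insert_commute)
  have "(b, c) \<notin> R" if "(a, b) \<in> R" for a b c
    using that by (auto simp: R_def)
  then have "trans R" by (auto simp: trans_def)
  then have "R\<^sup>* = R \<union> Id" by (simp only: rtrancl_trancl_reflcl trancl_id)
  moreover have "crown3 = Id_on (cycle_carrier (\<lambda>_. 0)) \<union> R"
  proof -
    have "cycle_carrier (\<lambda>_. 0) = X ` {1..3} \<union> Z ` {1..3}"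
      by (auto simp: cycle_carrier_def)
    moreover have "(\<Union>i\<in>{1..3}. {(X (cyc (i + 1)), Z i), (X (cyc (i + 1)), Z (cyc (i + 1)))}) = R"
      unfolding idx R_def by (simp add: cyc insert_commute)
    ultimately show ?thesis by (simp only: crown3_def)
  qed
  moreover have "R \<subseteq> cycle_carrier (\<lambda>_. 0) \<times> cycle_carrier (\<lambda>_. 0)"
    unfolding cycle_carrier_def R_def by simp
  moreover have "Restr (R \<union> Id) C = Id_on C \<union> R" if "R \<subseteq> C \<times> C" for C
    using that by (auto simp: Id_on_def)
  ultimately show ?thesis
    by (simp only: cycle_poset_def covers)
qed

definition grafting :: "'v rel \<Rightarrow> ('v \<Rightarrow> 'a rel) \<Rightarrow> ('v \<Rightarrow> 'a) \<Rightarrow> ('v \<times> 'a) rel" where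
  "grafting Q T r = {((a, b), (c, d)).
     a = c \<and> a \<in> Field Q \<and> (b, d) \<in> T a \<or>
     a \<noteq> c \<and> (a, c) \<in> Q \<and> (b, r a) \<in> T a \<and> (r c, d) \<in> T c}"

text \<open>\<open>prod_up a b w\<close> is $w_a \cdots w_b$ and \<open>prod_down a b w\<close> is $w_b \cdots w_a$.\<close>

definition prod_up :: "nat \<Rightarrow> nat \<Rightarrow> (nat \<Rightarrow> 'b list) \<Rightarrow> 'b list" where
  "prod_up a b w = concat (map w [a..<Suc b])"

definition prod_down :: "nat \<Rightarrow> nat \<Rightarrow> (nat \<Rightarrow> 'b list) \<Rightarrow> 'b list" where
  "prod_down a b w = concat (map w (rev [a..<Suc b]))"

text \<open>Here \<open>\<rho> v\<close> is the root of the tree grafted at \<open>v\<close> and \<open>W v\<close> are the admissible words there,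
  both as they sit in the grafting. The formulas for $X_i^+$ and $Z_i^+$ are instances of the
  single \<open>V_plus\<close>; likewise for the exponents $-$ and $\bullet$.\<close>

context
  fixes k :: "nat \<Rightarrow> nat" and \<rho> :: "cycle_elem \<Rightarrow> 'b" and W :: "cycle_elem \<Rightarrow> 'b tree_words"
begin

definition I_minus :: "cycle_elem \<Rightarrow> 'b list" where
  "I_minus v = U_neg (W v) @ D_one (W v)"

definition I_plus :: "cycle_elem \<Rightarrow> 'b list" where
  "I_plus v = U_one (W v) @ D_pos (W v)"

definition V_plus :: "cycle_elem \<Rightarrow> 'b list" where
  "V_plus v = [\<rho> v] @ U_pos (W v)"

definition V_minus :: "cycle_elem \<Rightarrow> 'b list" where
  "V_minus v = D_neg (W v) @ [\<rho> v]"

definition V_bullet :: "cycle_elem \<Rightarrow> 'b list" where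
  "V_bullet v = D_two (W v) @ [\<rho> v] @ U_two (W v)"

definition A_word :: "nat \<Rightarrow> 'b list \<Rightarrow> 'b list" where
  "A_word p x =
     prod_down 1 (k p) (\<lambda>j. U_neg (W (Y p j)) @ D_one (W (Y p j))) @ x @
     prod_up 1 (k p) (\<lambda>j. [\<rho> (Y p j)] @ U_pos (W (Y p j)))"

definition B_word :: "nat \<Rightarrow> 'b list \<Rightarrow> 'b list" where
  "B_word p x =
     prod_up 1 (k p) (\<lambda>j. D_neg (W (Y p j)) @ [\<rho> (Y p j)]) @ x @
     prod_down 1 (k p) (\<lambda>j. U_one (W (Y p j)) @ D_pos (W (Y p j)))"

definition C_word :: "nat \<Rightarrow> 'b list" where
  "C_word p = prod_up 1 (k p) (\<lambda>j. D_two (W (Y p j)) @ [\<rho> (Y p j)] @ U_two (W (Y p j)))"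

definition order1 :: "'b list" where
  "order1 =
     I_minus (Z 1) @ I_minus (X 2) @ A_word 1 (V_minus (X 1)) @ V_plus (X 2) @
     B_word 2 (V_plus (Z 1)) @ C_word 6 @ C_word 3 @ A_word 4 (V_minus (X 3)) @
     V_minus (Z 2) @ I_plus (Z 2) @ B_word 5 (V_bullet (Z 3)) @ I_plus (X 3) @ I_plus (X 1)"

definition order2 :: "'b list" where
  "order2 =
     I_minus (Z 2) @ A_word 3 (V_bullet (X 2)) @ I_minus (X 3) @ V_plus (X 3) @
     B_word 4 (V_plus (Z 2)) @ C_word 2 @ C_word 5 @ A_word 6 (V_bullet (X 1)) @
     V_minus (Z 3) @ B_word 1 (V_bullet (Z 1)) @ I_plus (Z 3)"

definition order3 :: "'b list" where
  "order3 =
     I_minus (Z 3) @ I_minus (X 1) @ V_plus (X 1) @ A_word 5 (V_bullet (X 3)) @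
     B_word 6 (V_plus (Z 3)) @ C_word 1 @ C_word 4 @ A_word 2 (V_minus (X 2)) @
     B_word 3 (V_bullet (Z 2)) @ V_minus (Z 1) @ I_plus (Z 1) @ I_plus (X 2)"

end

end

theory Submission
  imports Defs "HOL-Library.Product_Lexorder"
begin

text \<open>Fix a vertex \<open>v\<close> of the cycle poset. Each of the three linear orders restricts on the tree grafted
  at \<open>v\<close> to one of the words $U^- D_1\, v\, U^+$, $D^-\, v\, U_1 D^+$ and $D_2\, v\, U_2$, and each of
  these three kinds occurs exactly once. The three words form a realizer of the tree
  (\<open>tree_words_realize\<close>): on each side of the root they restrict to the two realizers that define
  admissible words, and an element on the lower side of the root is below one on the upper side only
  through the root. The latter holds because a tree has no cycles.

  For elements \<open>a\<close> and \<open>b\<close> of the trees at different vertices \<open>v\<close> and \<open>v'\<close>, the grafting has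
  $a \le b$ exactly when $v < v'$, $a \le v$ and $v' \le b$. The words of the first two kinds are cut next to
  the root: $U^- D_1 \mid v\, U^+$ and $D^-\, v \mid U_1 D^+$; the third one stays in one piece. The piece
  $D^-\, v$ consists of the elements $a \le v$ of the tree, and the piece $v\, U^+$ of the elements
  $b \ge v$. The three orders realize the grafting because
  the pieces are arranged so that

  \<^item> whenever not $v' \le v$, the tree at \<open>v\<close> entirely precedes the tree at \<open>v'\<close> in some order;
  \<^item> if $v < v'$, then the piece with the root \<open>v\<close> precedes the piece with the root \<open>v'\<close> in every order;
  \<^item> if $v < v'$, then $U_1 D^+$ of \<open>v\<close> follows the whole tree at \<open>v'\<close> in the order that contains it,
    and $U^- D_1$ of \<open>v'\<close> precedes the whole tree at \<open>v\<close> in the order that contains it.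

  The first condition refutes all false relations between incomparable or wrongly ordered vertices, the
  third one refutes the false relations with $v < v'$, and the second one secures the true relations.
  This argument is the locale \<open>slot_layout\<close> with its conclusion \<open>grafting_realizer\<close>, for any
  poset and any number of words.

  To check the conditions for the cycle poset, each piece gets a key, a pair of integers that
  describes its position in the order: a block number, and the height in the chain where a block runs
  through a whole chain. The conditions then become comparisons of keys, one for each pair of the
  twelve types of vertices (\<open>cycle_separated\<close> and \<open>cycle_nested\<close>).\<close>

section \<open>Words and their orders\<close>

lemma word_order_Nil [simp]: "word_order [] = {}"
  by (simp add: word_order_def)

lemma word_order_Cons: "word_order (x # xs) = Pair x ` set (x # xs) \<union> word_order xs"
proof -
  have "(a, b) \<in> word_order (x # xs) \<longleftrightarrow> a = x \<and> b \<in> set (x # xs) \<or> (a, b) \<in> word_order xs"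
    for a b
  proof
    assume "(a, b) \<in> word_order (x # xs)"
    then obtain i j where ij: "a = (x # xs) ! i" "b = (x # xs) ! j" "i \<le> j" "j < length (x # xs)"
      by (auto simp: word_order_def)
    show "a = x \<and> b \<in> set (x # xs) \<or> (a, b) \<in> word_order xs"
    proof (cases i)
      case 0
      then show ?thesis using ij(1,2) nth_mem[OF ij(4)] by simp
    next
      case (Suc i')
      then obtain j' where "j = Suc j'" using ij(3) by (cases j) auto
      then show ?thesis using ij Suc by (auto simp: word_order_def)
    qed
  next
    assume "a = x \<and> b \<in> set (x # xs) \<or> (a, b) \<in> word_order xs"
    then show "(a, b) \<in> word_order (x # xs)"
    proof
      assume "a = x \<and> b \<in> set (x # xs)"
      then obtain j where "a = (x # xs) ! 0 \<and> b = (x # xs) ! j \<and> 0 \<le> j \<and> j < length (x # xs)"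
        by (metis in_set_conv_nth nth_Cons_0 zero_le)
      then show ?thesis unfolding word_order_def by blast
    next
      assume "(a, b) \<in> word_order xs"
      then obtain i j where "a = xs ! i" "b = xs ! j" "i \<le> j" "j < length xs"
        by (auto simp: word_order_def)
      then have "a = (x # xs) ! Suc i \<and> b = (x # xs) ! Suc j \<and> Suc i \<le> Suc j \<and>
          Suc j < length (x # xs)"
        by simp
      then show ?thesis unfolding word_order_def by blast
    qed
  qed
  then show ?thesis by auto
qed

lemma word_order_append: "word_order (xs @ ys) = word_order xs \<union> word_order ys \<union> set xs \<times> set ys"
  by (induction xs) (auto simp: word_order_Cons)

lemma word_order_map: "word_order (map f xs) = map_prod f f ` word_order xs"
  by (induction xs) (auto simp: word_order_Cons image_Un image_image)

lemma word_order_map_Pair: "((v, a), (v, b)) \<in> word_order (map (Pair v) xs) \<longleftrightarrow> (a, b) \<in> word_order xs"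
  by (auto simp: word_order_map)

lemma word_order_in_set: "(a, b) \<in> word_order xs \<Longrightarrow> a \<in> set xs \<and> b \<in> set xs"
  by (induction xs) (auto simp: word_order_Cons)

lemma word_order_antisym:
  "distinct xs \<Longrightarrow> (a, b) \<in> word_order xs \<Longrightarrow> (b, a) \<in> word_order xs \<Longrightarrow> a = b"
  by (induction xs) (auto simp: word_order_Cons dest: word_order_in_set)

lemma realizerI:
  assumes "\<And>L. L \<in> set Ls \<Longrightarrow> distinct L \<and> set L = Field P"
    and "\<And>u v. u \<in> Field P \<Longrightarrow> v \<in> Field P \<Longrightarrow>
      (u, v) \<in> P \<longleftrightarrow> (\<forall>L\<in>set Ls. (u, v) \<in> word_order L)"
  shows "realizer P Ls"
  unfolding realizer_def linear_extension_def
  using assms by (metis FieldI1 FieldI2 subrelI)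

text \<open>A word cut into slots with strictly increasing keys is compared lexicographically: first by the
  keys of the slots, then inside the common slot. This reduces all comparisons in the long words
  below to comparisons of keys.\<close>

lemma word_order_concat:
  fixes key :: "'s \<Rightarrow> 'k::linorder"
  assumes "sorted_wrt (\<lambda>s t. key s < key t) ss" "distinct (concat (map f ss))"
    and "s \<in> set ss" "t \<in> set ss" "a \<in> set (f s)" "b \<in> set (f t)"
  shows "(a, b) \<in> word_order (concat (map f ss)) \<longleftrightarrow>
    key s < key t \<or> s = t \<and> (a, b) \<in> word_order (f s)"
  using assms
proof (induction ss)
  case Nil
  then show ?case by simp
next
  case (Cons u ss)
  have notin: "c \<notin> set (f u)" if "x \<in> set ss" "c \<in> set (f x)" for c x
    using Cons.prems(2) that by auto
  have later: "key u < key x" if "x \<in> set ss" for x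
    using Cons.prems(1) that by auto
  have inner: "c \<in> \<Union> (set ` f ` set ss)" "d \<in> \<Union> (set ` f ` set ss)"
    if "(c, d) \<in> word_order (concat (map f ss))" for c d
    using word_order_in_set[OF that] by auto
  have IH: ?case if "s \<in> set ss" "t \<in> set ss"
  proof -
    have "(a, b) \<in> word_order (concat (map f ss)) \<longleftrightarrow>
        key s < key t \<or> s = t \<and> (a, b) \<in> word_order (f s)"
      using Cons that by (intro Cons.IH) auto
    moreover have "a \<notin> set (f u)" using notin that(1) Cons.prems(5) by blast
    ultimately show ?thesis
      using word_order_in_set[of a b "f u"] by (auto simp: word_order_append)
  qed
  consider "s \<in> set ss" "t \<in> set ss" | "s = u" "t = u" | "s = u" "t \<in> set ss"
    | "s \<in> set ss" "t = u" using Cons.prems(3,4) by auto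
  then show ?case
  proof cases
    case 1
    then show ?thesis by (rule IH)
  next
    case 2
    then have "(a, b) \<notin> word_order (concat (map f ss))"
      using Cons.prems(5) inner(1)[of a b] notin by auto
    then show ?thesis
      using 2 Cons.prems(5,6) notin by (auto simp: word_order_append)
  next
    case 3
    then show ?thesis
      using Cons.prems(5,6) later by (auto simp: word_order_append)
  next
    case 4
    then have "b \<in> set (f u)" "a \<notin> set (f u)" using notin Cons.prems(5,6) by auto
    then have "(a, b) \<notin> word_order (concat (map f (u # ss)))"
      using inner[of a b] notin word_order_in_set[of a b "f u"] by (auto simp: word_order_append)
    moreover have "key u < key s" "s \<noteq> t" using later[of s] 4 by auto
    ultimately show ?thesis using 4 by auto
  qed
qed

section \<open>The two sides of a root in a tree poset\<close>

lemma graph_path_mono: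
  assumes "graph_path R p" "R \<subseteq> S"
  shows "graph_path S p"
proof -
  have "successively (\<lambda>a b. (a, b) \<in> R) p" using assms(1) by (simp add: graph_path_def)
  then have "successively (\<lambda>a b. (a, b) \<in> S) p"
    by (rule successively_mono) (use assms(2) in blast)
  then show ?thesis using assms(1) by (simp add: graph_path_def)
qed

lemma graph_path_of_rtrancl:
  assumes "(s, t) \<in> R\<^sup>*"
  shows "\<exists>p. graph_path R p \<and> hd p = s \<and> last p = t \<and> set p \<subseteq> insert s (Range R)"
  using assms
proof (induction rule: rtrancl_induct)
  case base
  have "graph_path R [s]" by (simp add: graph_path_def)
  then show ?case by (intro exI[of _ "[s]"]) simp
next
  case (step y z)
  then obtain p where p: "graph_path R p" "hd p = s" "last p = y" "set p \<subseteq> insert s (Range R)"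
    by blast
  show ?case
  proof (cases "z \<in> set p")
    case True
    then obtain ys zs where split: "p = ys @ z # zs" by (meson split_list)
    have "graph_path R (ys @ [z])"
      using p(1) unfolding split graph_path_def by (auto simp: successively_append_iff)
    moreover have "hd (ys @ [z]) = s" using p(2) unfolding split by (cases ys) auto
    moreover have "last (ys @ [z]) = z" "set (ys @ [z]) \<subseteq> insert s (Range R)"
      using p(4) unfolding split by auto
    ultimately show ?thesis by blast
  next
    case False
    have "graph_path R (p @ [z])"
      using p False step.hyps(2) unfolding graph_path_def by (auto simp: successively_append_iff)
    moreover have "hd (p @ [z]) = s" "last (p @ [z]) = z"
      using p(1,2) by (auto simp: graph_path_def)
    moreover have "set (p @ [z]) \<subseteq> insert s (Range R)"
      using p(4) step.hyps(2) by auto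
    ultimately show ?thesis by blast
  qed
qed

lemma rtrancl_of_successively:
  "successively (\<lambda>a b. (a, b) \<in> R) (s # q) \<Longrightarrow> (s, last (s # q)) \<in> R\<^sup>*"
proof (induction q arbitrary: s)
  case (Cons a q)
  then have "(s, a) \<in> R" "(a, last (a # q)) \<in> R\<^sup>*" by auto
  then show ?case by (simp add: converse_rtrancl_into_rtrancl)
qed simp

text \<open>The components of \<open>graph_minus T w\<close> are the branches of the tree at \<open>w\<close>; the sets \<open>U_set T w\<close>
  and \<open>D_set T w\<close> are the unions of the branches attached above and below \<open>w\<close>.\<close>

definition graph_minus :: "'a rel \<Rightarrow> 'a \<Rightarrow> 'a rel" where
  "graph_minus T w = Restr (cover_graph T) (- {w})"

lemma covers_subset: "covers T \<subseteq> T"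
  by (auto simp: covers_def)

text \<open>Paths from \<open>w\<close> are replaced by reachability in \<open>graph_minus T w\<close>, for which it is immediate that
  neighbours other than \<open>w\<close> stay on the same side.\<close>

lemma U_set_iff:
  assumes T: "Partial_order T"
  shows "t \<in> U_set T w \<longleftrightarrow> (\<exists>s. (w, s) \<in> covers T \<and> (s, t) \<in> (graph_minus T w)\<^sup>*)"
proof
  assume "t \<in> U_set T w"
  then obtain s q where path: "graph_path (cover_graph T) (w # s # q)"
    and last: "last (w # s # q) = t" and up: "(w, s) \<in> T"
    unfolding U_set_def by blast
  have ws: "w \<noteq> s" "(w, s) \<in> cover_graph T" using path by (auto simp: graph_path_def)
  have "(s, w) \<notin> T" using T up ws(1) by (auto simp: order_on_defs dest: antisymD)
  then have "(w, s) \<in> covers T"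
    using ws(2) covers_subset[of T] unfolding cover_graph_def by blast
  moreover have "successively (\<lambda>a b. (a, b) \<in> graph_minus T w) (s # q)"
  proof -
    have w: "w \<notin> set (s # q)" and "successively (\<lambda>a b. (a, b) \<in> cover_graph T) (s # q)"
      using path by (auto simp: graph_path_def)
    from this(2) show ?thesis
      by (rule successively_mono) (use w in \<open>auto simp: graph_minus_def\<close>)
  qed
  then have "(s, t) \<in> (graph_minus T w)\<^sup>*"
    using rtrancl_of_successively[of "graph_minus T w" s q] last by simp
  ultimately show "\<exists>s. (w, s) \<in> covers T \<and> (s, t) \<in> (graph_minus T w)\<^sup>*" by blast
next
  assume "\<exists>s. (w, s) \<in> covers T \<and> (s, t) \<in> (graph_minus T w)\<^sup>*"
  then obtain s where s: "(w, s) \<in> covers T" "(s, t) \<in> (graph_minus T w)\<^sup>*" by blast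
  obtain p where p: "graph_path (graph_minus T w) p" "hd p = s" "last p = t"
    "set p \<subseteq> insert s (Range (graph_minus T w))"
    using graph_path_of_rtrancl[OF s(2)] by blast
  obtain q where q: "p = s # q" using p(1,2) by (cases p) (auto simp: graph_path_def)
  have "s \<noteq> w" using s(1) by (auto simp: covers_def)
  then have w: "w \<notin> set p" using p(4) by (auto simp: graph_minus_def)
  have "graph_path (cover_graph T) p"
    using p(1) by (rule graph_path_mono) (simp add: graph_minus_def)
  then have "graph_path (cover_graph T) (w # s # q)"
    using w s(1) unfolding q graph_path_def by (simp add: cover_graph_def)
  moreover have "last (w # s # q) = t" using p(3) q by simp
  moreover have "(w, s) \<in> T" using s(1) covers_subset by blast
  moreover have "t \<in> Field T"
    using s(2)
  proof (cases rule: rtranclE)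
    case base
    then show ?thesis using \<open>(w, s) \<in> T\<close> by (auto intro: FieldI2)
  next
    case (step y)
    then have "(y, t) \<in> T \<or> (t, y) \<in> T"
      using covers_subset[of T] by (auto simp: graph_minus_def cover_graph_def)
    then show ?thesis by (auto intro: FieldI1 FieldI2)
  qed
  moreover have "t \<noteq> w" using w p(1,3) by (auto simp: graph_path_def)
  ultimately show "t \<in> U_set T w"
    unfolding U_set_def by (intro CollectI conjI exI[of _ s] exI[of _ q]) simp_all
qed

lemma cover_graph_converse: "cover_graph (T\<inverse>) = cover_graph T"
  by (auto simp: cover_graph_def covers_def)

text \<open>Reversing the order exchanges the two sides and keeps the cover graph, so the statements about
  \<open>D_set\<close> are dual to those about \<open>U_set\<close>.\<close>

lemma D_set_eq: "D_set T w = U_set (T\<inverse>) w"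
  by (simp add: D_set_def U_set_def cover_graph_converse)

lemma Partial_order_converse: "Partial_order T \<Longrightarrow> Partial_order (T\<inverse>)"
  by (auto simp: order_on_defs refl_on_def antisym_on_def Field_def)

lemma D_set_iff:
  assumes "Partial_order T"
  shows "t \<in> D_set T w \<longleftrightarrow> (\<exists>s. (s, w) \<in> covers T \<and> (s, t) \<in> (graph_minus T w)\<^sup>*)"
proof -
  have "graph_minus (T\<inverse>) w = graph_minus T w" "covers (T\<inverse>) = (covers T)\<inverse>"
    by (auto simp: graph_minus_def cover_graph_converse covers_def)
  then show ?thesis
    unfolding D_set_eq U_set_iff[OF Partial_order_converse[OF assms]] by simp
qed

text \<open>A branch attached both above and below \<open>w\<close> would contain two different neighbours of \<open>w\<close>, and a
  path between them in the branch would close up to a cycle through \<open>w\<close>.\<close>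

lemma tree_sides_disjoint:
  assumes "tree_poset T"
  shows "U_set T w \<inter> D_set T w = {}"
proof (rule ccontr)
  assume "U_set T w \<inter> D_set T w \<noteq> {}"
  then obtain t where t: "t \<in> U_set T w" "t \<in> D_set T w" by blast
  have po: "Partial_order T" using assms by (simp add: tree_poset_def finite_poset_def)
  from t obtain s s' where s: "(w, s) \<in> covers T" "(s, t) \<in> (graph_minus T w)\<^sup>*"
    and s': "(s', w) \<in> covers T" "(s', t) \<in> (graph_minus T w)\<^sup>*"
    unfolding U_set_iff[OF po] D_set_iff[OF po] by blast
  have "sym (graph_minus T w)"
    by (auto simp: sym_def graph_minus_def cover_graph_def)
  then have "(t, s') \<in> (graph_minus T w)\<^sup>*" using s'(2) by (metis sym_rtrancl symD)
  with s(2) have "(s, s') \<in> (graph_minus T w)\<^sup>*" by (rule rtrancl_trans)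
  from graph_path_of_rtrancl[OF this]
  obtain p where p: "graph_path (graph_minus T w) p" "hd p = s" "last p = s'"
    "set p \<subseteq> insert s (Range (graph_minus T w))"
    by blast
  have "s \<noteq> w" using s(1) unfolding covers_def by blast
  then have w: "w \<notin> set p" using p(4) unfolding graph_minus_def by blast
  have "(w, s) \<in> T" "(s', w) \<in> T" using s(1) s'(1) covers_subset by blast+
  then have "s \<noteq> s'" using po \<open>s \<noteq> w\<close> unfolding order_on_defs by (blast dest: antisymD)
  obtain q where q: "p = s # q" using p(1,2) by (cases p) (auto simp: graph_path_def)
  then have "q \<noteq> []" using p(3) \<open>s \<noteq> s'\<close> by (cases q) auto
  have "graph_path (cover_graph T) p"
    using p(1) by (rule graph_path_mono) (simp add: graph_minus_def)
  then have "graph_path (cover_graph T) (w # p)"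
    using w s(1) unfolding q graph_path_def by (simp add: cover_graph_def)
  moreover have "3 \<le> length (w # p)" using q \<open>q \<noteq> []\<close> by (cases q) auto
  moreover have "(last (w # p), hd (w # p)) \<in> cover_graph T"
    using p(3) q s'(1) by (simp add: cover_graph_def)
  ultimately have "graph_cycle (cover_graph T) (w # p)" by (simp add: graph_cycle_def)
  then show False using assms by (auto simp: tree_poset_def is_tree_def)
qed

lemma tree_sides_cover:
  assumes "tree_poset T" "w \<in> Field T"
  shows "Field T = insert w (U_set T w \<union> D_set T w)"
proof -
  have "t \<in> U_set T w \<union> D_set T w" if t: "t \<in> Field T" "t \<noteq> w" for t
  proof -
    obtain p where p: "graph_path (cover_graph T) p" "hd p = w" "last p = t"
      using assms t(1) unfolding tree_poset_def is_tree_def by blast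
    obtain s q where "p = w # s # q"
    proof (cases p)
      case Nil
      then show ?thesis using p(1) by (simp add: graph_path_def)
    next
      case (Cons a l)
      then show ?thesis using that p(2,3) t(2) by (cases l) auto
    qed
    moreover from this have "(w, s) \<in> T \<or> (s, w) \<in> T"
      using p(1) covers_subset[of T] by (auto simp: graph_path_def cover_graph_def)
    ultimately show ?thesis using p t unfolding U_set_def D_set_def by blast
  qed
  moreover have "U_set T w \<union> D_set T w \<subseteq> Field T" unfolding U_set_def D_set_def by blast
  ultimately show ?thesis using assms(2) by blast
qed

text \<open>Every relation of a finite poset is refined to a saturated chain, by induction on the size of the
  interval.\<close>

lemma finite_poset_rtrancl_covers:
  assumes "finite_poset T" "(a, b) \<in> T"
  shows "(a, b) \<in> (covers T)\<^sup>*"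
  using assms(2)
proof (induction "card {c. (a, c) \<in> T \<and> (c, b) \<in> T}" arbitrary: a b rule: less_induct)
  case less
  have po: "refl_on (Field T) T" "trans T" "antisym T" and fin: "finite (Field T)"
    using assms(1) by (auto simp: finite_poset_def order_on_defs)
  show ?case
  proof (cases "a = b \<or> (a, b) \<in> covers T")
    case True
    then show ?thesis by auto
  next
    case False
    then obtain c where c: "c \<noteq> a" "c \<noteq> b" "(a, c) \<in> T" "(c, b) \<in> T"
      using less.prems by (auto simp: covers_def)
    have fin': "finite {c. (a, c) \<in> T \<and> (c, b) \<in> T}"
      using fin by (rule finite_subset[rotated]) (auto intro: FieldI1 FieldI2)
    have mem: "a \<in> {c. (a, c) \<in> T \<and> (c, b) \<in> T}" "b \<in> {c. (a, c) \<in> T \<and> (c, b) \<in> T}"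
      using po(1) less.prems by (auto dest: refl_onD intro: FieldI1 FieldI2)
    have "card {d. (a, d) \<in> T \<and> (d, c) \<in> T} < card {c. (a, c) \<in> T \<and> (c, b) \<in> T}"
      using c po mem by (intro psubset_card_mono[OF fin']) (auto dest: transD antisymD)
    moreover have "card {d. (c, d) \<in> T \<and> (d, b) \<in> T} < card {c. (a, c) \<in> T \<and> (c, b) \<in> T}"
      using c po mem by (intro psubset_card_mono[OF fin']) (auto dest: transD antisymD)
    ultimately have "(a, c) \<in> (covers T)\<^sup>*" "(c, b) \<in> (covers T)\<^sup>*"
      using less.hyps c by blast+
    then show ?thesis by (rule rtrancl_trans)
  qed
qed

text \<open>A saturated chain upwards from a point on the upper side can only leave its branch through \<open>w\<close>, but
  then its last point before \<open>w\<close> would be covered by \<open>w\<close> and so lie on the lower side.\<close>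

lemma U_set_upward_closed:
  assumes T: "tree_poset T" and u: "u \<in> U_set T w" and ut: "(u, t) \<in> T"
  shows "t \<in> U_set T w"
proof -
  have po: "Partial_order T" using T by (simp add: tree_poset_def finite_poset_def)
  have "(u, t) \<in> (covers T)\<^sup>*"
    using T ut by (intro finite_poset_rtrancl_covers) (auto simp: tree_poset_def)
  then show ?thesis
    using u
  proof (induction rule: converse_rtrancl_induct)
    case (step y z)
    have "y \<noteq> w" using step.prems unfolding U_set_def by blast
    show ?case
    proof (cases "z = w")
      case True
      then have "y \<in> D_set T w" using step.hyps(1) unfolding D_set_iff[OF po] by blast
      then show ?thesis using step.prems tree_sides_disjoint[OF T, of w] by blast
    next
      case False
      then have "(y, z) \<in> graph_minus T w"
        using step.hyps(1) \<open>y \<noteq> w\<close> by (auto simp: graph_minus_def cover_graph_def)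
      then have "z \<in> U_set T w"
        using step.prems unfolding U_set_iff[OF po] by (meson rtrancl.rtrancl_into_rtrancl)
      then show ?thesis by (rule step.IH)
    qed
  qed
qed

text \<open>A saturated chain from the lower to the upper side must pass through \<open>w\<close>.\<close>

lemma below_across_root:
  assumes T: "tree_poset T" and w: "w \<in> Field T" and d: "d \<in> D_set T w" and u: "u \<in> U_set T w"
    and du: "(d, u) \<in> T"
  shows "(d, w) \<in> T \<and> (w, u) \<in> T"
proof -
  have po: "Partial_order T" using T by (simp add: tree_poset_def finite_poset_def)
  have tr: "trans T" and re: "(w, w) \<in> T"
    using po w by (auto simp: order_on_defs dest: refl_onD)
  have "(d, u) \<in> (covers T)\<^sup>*"
    using T du by (intro finite_poset_rtrancl_covers) (auto simp: tree_poset_def)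
  then have "u \<in> D_set T w \<or> (d, w) \<in> T \<and> (w, u) \<in> T"
  proof (induction rule: rtrancl_induct)
    case base
    then show ?case using d by simp
  next
    case (step y z)
    have "(y, z) \<in> T" using step.hyps(2) covers_subset by blast
    show ?case
    proof (cases "y \<in> D_set T w")
      case False
      then show ?thesis using step.IH \<open>(y, z) \<in> T\<close> tr by (blast dest: transD)
    next
      case y: True
      show ?thesis
      proof (cases "z = w")
        case True
        have "(d, z) \<in> (covers T)\<^sup>*" using step.hyps by (rule rtrancl.rtrancl_into_rtrancl)
        moreover have "(covers T)\<^sup>* \<subseteq> T\<^sup>*" by (rule rtrancl_mono[OF covers_subset])
        moreover have "T\<^sup>* = T \<union> Id" using tr by (simp only: rtrancl_trancl_reflcl trancl_id)
        moreover have "d \<noteq> w" using d unfolding D_set_def by blast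
        ultimately show ?thesis using True re by blast
      next
        case False
        moreover have "y \<noteq> w" using y unfolding D_set_def by blast
        ultimately have "(y, z) \<in> graph_minus T w"
          using step.hyps(2) by (auto simp: graph_minus_def cover_graph_def)
        then show ?thesis
          using y unfolding D_set_iff[OF po] by (meson rtrancl.rtrancl_into_rtrancl)
      qed
    qed
  qed
  then show ?thesis using u tree_sides_disjoint[OF T, of w] by blast
qed

section \<open>The three words of a rooted tree\<close>

text \<open>Each of the three words restricts on each tree to one of three words, according to the kind of the
  tree there. For the kinds \<open>Plus\<close> and \<open>Minus\<close> the word is cut next to the root, and material of
  other trees may be inserted at the cut; for \<open>Bullet\<close> it stays in one piece, and the high part is
  empty.\<close>

datatype kind = Plus | Minus | Bullet

fun low_word :: "kind \<Rightarrow> 'a \<Rightarrow> 'a tree_words \<Rightarrow> 'a list" where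
  "low_word Plus w A = U_neg A @ D_one A"
| "low_word Minus w A = D_neg A @ [w]"
| "low_word Bullet w A = D_two A @ [w] @ U_two A"

fun high_word :: "kind \<Rightarrow> 'a \<Rightarrow> 'a tree_words \<Rightarrow> 'a list" where
  "high_word Plus w A = [w] @ U_pos A"
| "high_word Minus w A = U_one A @ D_pos A"
| "high_word Bullet w A = []"

definition tree_word :: "kind \<Rightarrow> 'a \<Rightarrow> 'a tree_words \<Rightarrow> 'a list" where
  "tree_word \<kappa> w A = low_word \<kappa> w A @ high_word \<kappa> w A"

lemma Field_Restr_subset:
  assumes "Partial_order T" "S \<subseteq> Field T"
  shows "Field (Restr T S) = S"
proof
  show "S \<subseteq> Field (Restr T S)"
  proof
    fix x assume "x \<in> S"
    then have "(x, x) \<in> Restr T S"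
      using assms by (auto simp: order_on_defs dest: refl_onD)
    then show "x \<in> Field (Restr T S)" by (rule FieldI1)
  qed
qed (auto simp: Field_def)

lemma linear_extension_Restr:
  assumes "Partial_order T" "S \<subseteq> Field T" "linear_extension (Restr T S) xs"
  shows "distinct xs" "set xs = S"
  using assms(3) Field_Restr_subset[OF assms(1,2)] by (auto simp: linear_extension_def)

lemma realizer_Restr:
  assumes "Partial_order T" "S \<subseteq> Field T" "realizer (Restr T S) Ls" "u \<in> S" "v \<in> S"
  shows "(u, v) \<in> T \<longleftrightarrow> (\<forall>L\<in>set Ls. (u, v) \<in> word_order L)"
  using assms(3,4,5) Field_Restr_subset[OF assms(1,2)] by (auto simp: realizer_def)

context
  fixes T :: "'a rel" and w :: 'a and A :: "'a tree_words"
  assumes rooted: "rooted_tree_poset T w" and adm: "admissible_words T w A"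
begin

lemma rooted_basics:
  shows "Partial_order T" "tree_poset T" "w \<in> Field T"
    "U_set T w \<union> {w} \<subseteq> Field T" "D_set T w \<union> {w} \<subseteq> Field T"
    "w \<notin> U_set T w" "w \<notin> D_set T w"
proof -
  show "w \<in> Field T" using rooted by (simp add: rooted_tree_poset_def)
  then show "U_set T w \<union> {w} \<subseteq> Field T" "D_set T w \<union> {w} \<subseteq> Field T"
    "w \<notin> U_set T w" "w \<notin> D_set T w"
    unfolding U_set_def D_set_def by blast+
qed (use rooted in \<open>simp_all add: rooted_tree_poset_def tree_poset_def finite_poset_def\<close>)

lemma admissible_sets:
  shows "distinct (U_neg A)" "set (U_neg A) = U_neg_set T w"
    "distinct (U_pos A)" "set (U_pos A) = U_pos_set T w"
    "distinct (U_one A)" "set (U_one A) = U_set T w"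
    "distinct (U_two A)" "set (U_two A) = U_set T w"
    "distinct (D_neg A)" "set (D_neg A) = D_neg_set T w"
    "distinct (D_pos A)" "set (D_pos A) = D_pos_set T w"
    "distinct (D_one A)" "set (D_one A) = D_set T w"
    "distinct (D_two A)" "set (D_two A) = D_set T w"
proof -
  have sub: "U_neg_set T w \<subseteq> Field T" "U_pos_set T w \<subseteq> Field T" "U_set T w \<subseteq> Field T"
    "D_neg_set T w \<subseteq> Field T" "D_pos_set T w \<subseteq> Field T" "D_set T w \<subseteq> Field T"
    using rooted_basics(4,5)
    unfolding U_neg_set_def U_pos_set_def D_neg_set_def D_pos_set_def by blast+
  note le = linear_extension_Restr[OF rooted_basics(1)]
  note ad = adm[unfolded admissible_words_def]
  show "distinct (U_neg A)" "set (U_neg A) = U_neg_set T w" using le[OF sub(1)] ad by blast+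
  show "distinct (U_pos A)" "set (U_pos A) = U_pos_set T w" using le[OF sub(2)] ad by blast+
  show "distinct (U_one A)" "set (U_one A) = U_set T w" using le[OF sub(3)] ad by blast+
  show "distinct (U_two A)" "set (U_two A) = U_set T w" using le[OF sub(3)] ad by blast+
  show "distinct (D_neg A)" "set (D_neg A) = D_neg_set T w" using le[OF sub(4)] ad by blast+
  show "distinct (D_pos A)" "set (D_pos A) = D_pos_set T w" using le[OF sub(5)] ad by blast+
  show "distinct (D_one A)" "set (D_one A) = D_set T w" using le[OF sub(6)] ad by blast+
  show "distinct (D_two A)" "set (D_two A) = D_set T w" using le[OF sub(6)] ad by blast+
qed

lemma U_split: "U_set T w = U_pos_set T w \<union> U_neg_set T w" "U_pos_set T w \<inter> U_neg_set T w = {}"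
  unfolding U_neg_set_def U_pos_set_def by blast+

lemma D_split: "D_set T w = D_neg_set T w \<union> D_pos_set T w" "D_neg_set T w \<inter> D_pos_set T w = {}"
  unfolding D_pos_set_def D_neg_set_def by blast+

lemma UD_disjoint: "U_set T w \<inter> D_set T w = {}"
  by (rule tree_sides_disjoint[OF rooted_basics(2)])

lemma tree_word_linear: "distinct (tree_word \<kappa> w A) \<and> set (tree_word \<kappa> w A) = Field T"
proof -
  have F: "Field T = insert w (U_set T w \<union> D_set T w)"
    by (rule tree_sides_cover[OF rooted_basics(2,3)])
  show ?thesis
    unfolding F using U_split D_split UD_disjoint rooted_basics(6,7)
    by (cases \<kappa>) (auto simp: tree_word_def admissible_sets)
qed

text \<open>On the upper side together with the root, the three words of the tree restrict to the three words
  of the first realizer in the definition of admissible words; on the lower side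
  (\<open>lower_side_order\<close>) to those of the second.\<close>

lemma upper_side_order:
  assumes "u \<in> U_set T w \<union> {w}" "v \<in> U_set T w \<union> {w}"
  shows "(u, v) \<in> T \<longleftrightarrow> (\<forall>\<kappa>. (u, v) \<in> word_order (tree_word \<kappa> w A))"
proof -
  have real: "realizer (Restr T (U_set T w \<union> {w}))
      [U_neg A @ [w] @ U_pos A, [w] @ U_one A, [w] @ U_two A]"
    using adm unfolding admissible_words_def by blast
  have "(u, v) \<in> T \<longleftrightarrow> (u, v) \<in> word_order (U_neg A @ [w] @ U_pos A) \<and>
      (u, v) \<in> word_order ([w] @ U_one A) \<and> (u, v) \<in> word_order ([w] @ U_two A)"
    using realizer_Restr[OF rooted_basics(1,4) real assms] by simp
  moreover have "u \<notin> D_set T w" "v \<notin> D_set T w"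
    using assms UD_disjoint rooted_basics(7) by blast+
  then have "(u, v) \<in> word_order (tree_word Plus w A) \<longleftrightarrow>
      (u, v) \<in> word_order (U_neg A @ [w] @ U_pos A)"
    "(u, v) \<in> word_order (tree_word Minus w A) \<longleftrightarrow> (u, v) \<in> word_order ([w] @ U_one A)"
    "(u, v) \<in> word_order (tree_word Bullet w A) \<longleftrightarrow> (u, v) \<in> word_order ([w] @ U_two A)"
    using D_split
    by (auto simp: tree_word_def word_order_append word_order_Cons admissible_sets
        dest: word_order_in_set)
  ultimately show ?thesis by (metis (full_types) kind.exhaust)
qed

lemma lower_side_order:
  assumes "u \<in> D_set T w \<union> {w}" "v \<in> D_set T w \<union> {w}"
  shows "(u, v) \<in> T \<longleftrightarrow> (\<forall>\<kappa>. (u, v) \<in> word_order (tree_word \<kappa> w A))"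
proof -
  have real: "realizer (Restr T (D_set T w \<union> {w}))
      [D_neg A @ [w] @ D_pos A, D_one A @ [w], D_two A @ [w]]"
    using adm unfolding admissible_words_def by blast
  have "(u, v) \<in> T \<longleftrightarrow> (u, v) \<in> word_order (D_neg A @ [w] @ D_pos A) \<and>
      (u, v) \<in> word_order (D_one A @ [w]) \<and> (u, v) \<in> word_order (D_two A @ [w])"
    using realizer_Restr[OF rooted_basics(1,5) real assms] by simp
  moreover have "u \<notin> U_set T w" "v \<notin> U_set T w"
    using assms UD_disjoint rooted_basics(6) by blast+
  then have "(u, v) \<in> word_order (tree_word Minus w A) \<longleftrightarrow>
      (u, v) \<in> word_order (D_neg A @ [w] @ D_pos A)"
    "(u, v) \<in> word_order (tree_word Plus w A) \<longleftrightarrow> (u, v) \<in> word_order (D_one A @ [w])"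
    "(u, v) \<in> word_order (tree_word Bullet w A) \<longleftrightarrow> (u, v) \<in> word_order (D_two A @ [w])"
    using U_split
    by (auto simp: tree_word_def word_order_append word_order_Cons admissible_sets
        dest: word_order_in_set)
  ultimately show ?thesis by (metis (full_types) kind.exhaust)
qed

text \<open>Across the root, the word of kind \<open>Bullet\<close> puts the lower side before the upper side, and nothing
  on the upper side is below anything on the lower side. Conversely, \<open>d\<close> on the lower side is below
  \<open>u\<close> on the upper side exactly when \<open>d \<le> w\<close> and \<open>w \<le> u\<close>; the word of kind \<open>Minus\<close> tests
  the first condition and the word of kind \<open>Plus\<close> the second.\<close>

lemma tree_words_realize:
  assumes "u \<in> Field T" "v \<in> Field T"
  shows "(u, v) \<in> T \<longleftrightarrow> (\<forall>\<kappa>. (u, v) \<in> word_order (tree_word \<kappa> w A))"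
proof -
  have F: "Field T = insert w (U_set T w \<union> D_set T w)"
    by (rule tree_sides_cover[OF rooted_basics(2,3)])
  consider "u \<in> U_set T w \<union> {w}" "v \<in> U_set T w \<union> {w}"
    | "u \<in> D_set T w \<union> {w}" "v \<in> D_set T w \<union> {w}"
    | "u \<in> U_set T w" "v \<in> D_set T w" | "u \<in> D_set T w" "v \<in> U_set T w"
    using assms F by blast
  then show ?thesis
  proof cases
    case 1
    then show ?thesis by (rule upper_side_order)
  next
    case 2
    then show ?thesis by (rule lower_side_order)
  next
    case 3
    then have "(u, v) \<notin> T"
      using U_set_upward_closed[OF rooted_basics(2) 3(1)] UD_disjoint by blast
    moreover have "(v, u) \<in> word_order (tree_word Bullet w A)"
      using 3 by (simp add: tree_word_def word_order_append admissible_sets)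
    then have "(u, v) \<notin> word_order (tree_word Bullet w A)"
      using word_order_antisym[of "tree_word Bullet w A" u v] tree_word_linear[of Bullet]
        UD_disjoint 3 by blast
    ultimately show ?thesis by blast
  next
    case 4
    have tr: "trans T" using rooted_basics(1) by (simp add: order_on_defs)
    have T: "(u, v) \<in> T \<longleftrightarrow> (u, w) \<in> T \<and> (w, v) \<in> T"
      using below_across_root[OF rooted_basics(2,3) 4] transD[OF tr] by blast
    have "u \<in> Field T" "v \<in> Field T" "u \<noteq> v" by (use assms UD_disjoint 4 in auto)
    have swap: "(u, v) \<notin> word_order (tree_word \<kappa> w A)" if "(v, u) \<in> word_order (tree_word \<kappa> w A)"
      for \<kappa>
      using word_order_antisym[of "tree_word \<kappa> w A" u v] tree_word_linear[of \<kappa>] that \<open>u \<noteq> v\<close>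
      by blast
    have "(u, v) \<in> word_order (tree_word Bullet w A)"
      using 4 by (simp add: tree_word_def word_order_append admissible_sets)
    moreover have "(u, v) \<in> word_order (tree_word Plus w A) \<longleftrightarrow> (w, v) \<in> T"
    proof (cases "(w, v) \<in> T")
      case True
      then show ?thesis
        using 4 by (simp add: tree_word_def word_order_append admissible_sets U_pos_set_def)
    next
      case False
      then have "(v, u) \<in> word_order (tree_word Plus w A)"
        using 4 by (simp add: tree_word_def word_order_append admissible_sets U_pos_set_def
            U_neg_set_def)
      then show ?thesis using False swap by blast
    qed
    moreover have "(u, v) \<in> word_order (tree_word Minus w A) \<longleftrightarrow> (u, w) \<in> T"
    proof (cases "(u, w) \<in> T")
      case True
      then show ?thesis
        using 4 by (simp add: tree_word_def word_order_append admissible_sets D_neg_set_def)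
    next
      case False
      then have "(v, u) \<in> word_order (tree_word Minus w A)"
        using 4 by (simp add: tree_word_def word_order_append word_order_Cons admissible_sets
            D_neg_set_def D_pos_set_def)
      then show ?thesis using False swap by blast
    qed
    ultimately show ?thesis unfolding T by (metis (full_types) kind.exhaust)
  qed
qed

text \<open>The elements through which a tree communicates with larger vertices of the grafting are those below
  its root, and they form the low part of kind \<open>Minus\<close>; those communicating with smaller vertices
  form the complement of the low part of kind \<open>Plus\<close> (\<open>above_root_iff\<close>).\<close>

lemma below_root_iff:
  assumes "a \<in> Field T"
  shows "(a, w) \<in> T \<longleftrightarrow> a \<in> set (low_word Minus w A)"
proof -
  have ww: "(w, w) \<in> T"
    using rooted_basics(1,3) by (auto simp: order_on_defs dest: refl_onD)
  have "(a, w) \<notin> T" if "a \<in> U_set T w"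
    using U_set_upward_closed[OF rooted_basics(2) that] rooted_basics(6) by blast
  moreover have "a \<in> insert w (U_set T w \<union> D_set T w)"
    using assms tree_sides_cover[OF rooted_basics(2,3)] by blast
  ultimately show ?thesis
    using ww UD_disjoint by (auto simp: admissible_sets D_neg_set_def)
qed

lemma above_root_iff:
  assumes "b \<in> Field T"
  shows "(w, b) \<in> T \<longleftrightarrow> b \<notin> set (low_word Plus w A)"
proof -
  have ww: "(w, w) \<in> T"
    using rooted_basics(1,3) by (auto simp: order_on_defs dest: refl_onD)
  have "(w, b) \<notin> T" if b: "b \<in> D_set T w"
  proof
    assume "(w, b) \<in> T"
    then have "(w, b) \<in> word_order (tree_word Bullet w A)"
      using tree_words_realize[OF rooted_basics(3) assms] by blast
    moreover have "(b, w) \<in> word_order (tree_word Bullet w A)"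
      using b by (simp add: tree_word_def word_order_append admissible_sets)
    ultimately have "w = b"
      using word_order_antisym[of "tree_word Bullet w A" w b] tree_word_linear[of Bullet] by blast
    then show False using b rooted_basics(7) by blast
  qed
  moreover have "b \<in> insert w (U_set T w \<union> D_set T w)"
    using assms tree_sides_cover[OF rooted_basics(2,3)] by blast
  ultimately show ?thesis
    using ww UD_disjoint rooted_basics(6,7) by (auto simp: admissible_sets U_neg_set_def U_pos_set_def)
qed

end

section \<open>Words on a grafting assembled from slots\<close>

datatype 'v slot = Low 'v | High 'v

lemma distinct_concat_map:
  assumes "distinct ss" "\<And>s. s \<in> set ss \<Longrightarrow> distinct (f s)"
    and "\<And>s t. s \<in> set ss \<Longrightarrow> t \<in> set ss \<Longrightarrow> s \<noteq> t \<Longrightarrow> set (f s) \<inter> set (f t) = {}"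
  shows "distinct (concat (map f ss))"
  using assms
proof (induction ss)
  case (Cons u ss)
  have "distinct (concat (map f ss))" using Cons.prems by (intro Cons.IH) auto
  moreover have "set (f u) \<inter> set (f t) = {}" if "t \<in> set ss" for t
    using Cons.prems(1) that by (intro Cons.prems(3)) auto
  ultimately show ?case using Cons.prems(2)[of u] by auto
qed simp

lemma distinct_if_sorted_by_key:
  fixes key :: "'s \<Rightarrow> 'k::linorder"
  shows "sorted_wrt (\<lambda>s t. key s < key t) ss \<Longrightarrow> distinct ss"
  by (induction ss) auto

text \<open>For each \<open>n\<close> in \<open>ns\<close>, the word of index \<open>n\<close> lists slots in the order of their keys; the slots
  \<open>Low v\<close> and \<open>High v\<close> hold the two parts of the word of the tree at \<open>v\<close>. The last four assumptions
  are what makes the words a realizer. By \<open>separated\<close>, the tree at \<open>v\<close> precedes the tree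
  at \<open>v'\<close> as a whole in some word unless this would contradict \<open>v' \<le> v\<close>. By \<open>root_less\<close>, the
  roots appear in the right order in every word. By \<open>Minus_encloses\<close>, the elements of the tree at
  \<open>v\<close> that are not below its root come after the whole tree at a larger vertex \<open>v'\<close> in the word where
  \<open>v\<close> has kind \<open>Minus\<close>; \<open>Plus_encloses\<close> is the dual condition on the tree at \<open>v'\<close>.\<close>

locale slot_layout =
  fixes Q :: "'v rel" and T :: "'v \<Rightarrow> 'a rel" and r :: "'v \<Rightarrow> 'a" and W :: "'v \<Rightarrow> 'a tree_words"
    and ns :: "'n list" and kind :: "'n \<Rightarrow> 'v \<Rightarrow> kind" and slots :: "'n \<Rightarrow> 'v slot list"
    and key :: "'n \<Rightarrow> 'v slot \<Rightarrow> 'k::linorder"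
  assumes partial_order: "Partial_order Q"
    and rooted: "v \<in> Field Q \<Longrightarrow> rooted_tree_poset (T v) (r v)"
    and admissible: "v \<in> Field Q \<Longrightarrow> admissible_words (T v) (r v) (W v)"
    and sorted: "n \<in> set ns \<Longrightarrow> sorted_wrt (\<lambda>s t. key n s < key n t) (slots n)"
    and set_slots: "n \<in> set ns \<Longrightarrow>
      set (slots n) = Low ` Field Q \<union> High ` {v \<in> Field Q. kind n v \<noteq> Bullet}"
    and key_Bullet: "n \<in> set ns \<Longrightarrow> v \<in> Field Q \<Longrightarrow> kind n v = Bullet \<Longrightarrow>
      key n (High v) = key n (Low v)"
    and key_less: "n \<in> set ns \<Longrightarrow> v \<in> Field Q \<Longrightarrow> kind n v \<noteq> Bullet \<Longrightarrow>
      key n (Low v) < key n (High v)"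
    and all_kinds: "v \<in> Field Q \<Longrightarrow> \<exists>n\<in>set ns. kind n v = \<kappa>"
    and separated: "v \<in> Field Q \<Longrightarrow> v' \<in> Field Q \<Longrightarrow> (v', v) \<notin> Q \<Longrightarrow>
      \<exists>n\<in>set ns. key n (High v) < key n (Low v')"
    and root_less: "n \<in> set ns \<Longrightarrow> (v, v') \<in> Q \<Longrightarrow> v \<noteq> v' \<Longrightarrow>
      key n (if kind n v = Plus then High v else Low v) <
      key n (if kind n v' = Plus then High v' else Low v')"
    and Minus_encloses: "n \<in> set ns \<Longrightarrow> (v, v') \<in> Q \<Longrightarrow> v \<noteq> v' \<Longrightarrow> kind n v = Minus \<Longrightarrow>
      key n (High v') < key n (High v)"
    and Plus_encloses: "n \<in> set ns \<Longrightarrow> (v, v') \<in> Q \<Longrightarrow> v \<noteq> v' \<Longrightarrow> kind n v' = Plus \<Longrightarrow>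
      key n (Low v') < key n (Low v)"
begin

definition slot_word :: "'n \<Rightarrow> 'v slot \<Rightarrow> ('v \<times> 'a) list" where
  "slot_word n s = (case s of
     Low v \<Rightarrow> map (Pair v) (low_word (kind n v) (r v) (W v))
   | High v \<Rightarrow> map (Pair v) (high_word (kind n v) (r v) (W v)))"

definition word :: "'n \<Rightarrow> ('v \<times> 'a) list" where
  "word n = concat (map (slot_word n) (slots n))"

text \<open>Only meaningful for \<open>a\<close> in the tree at \<open>v\<close>.\<close>

definition slot_of :: "'n \<Rightarrow> 'v \<Rightarrow> 'a \<Rightarrow> 'v slot" where
  "slot_of n v a = (if a \<in> set (low_word (kind n v) (r v) (W v)) then Low v else High v)"

lemma tree_word_parts:
  assumes "v \<in> Field Q"
  shows "distinct (low_word (kind n v) (r v) (W v))" "distinct (high_word (kind n v) (r v) (W v))"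
    "set (low_word (kind n v) (r v) (W v)) \<inter> set (high_word (kind n v) (r v) (W v)) = {}"
    "set (low_word (kind n v) (r v) (W v)) \<union> set (high_word (kind n v) (r v) (W v)) = Field (T v)"
  using tree_word_linear[OF rooted[OF assms] admissible[OF assms], of "kind n v"]
  by (auto simp: tree_word_def)

lemma distinct_word:
  assumes n: "n \<in> set ns"
  shows "distinct (word n)"
  unfolding word_def
proof (rule distinct_concat_map)
  show "distinct (slots n)" using sorted[OF n] by (rule distinct_if_sorted_by_key)
next
  fix s assume "s \<in> set (slots n)"
  then show "distinct (slot_word n s)"
    using tree_word_parts(1,2) set_slots[OF n] by (auto simp: slot_word_def distinct_map inj_on_def)
next
  fix s t assume "s \<in> set (slots n)" "t \<in> set (slots n)" "s \<noteq> t"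
  then show "set (slot_word n s) \<inter> set (slot_word n t) = {}"
    using tree_word_parts(3) set_slots[OF n] by (auto simp: slot_word_def split: slot.splits)
qed

lemma slot_of_mem:
  assumes n: "n \<in> set ns" and v: "v \<in> Field Q" and a: "a \<in> Field (T v)"
  shows "slot_of n v a \<in> set (slots n)" "(v, a) \<in> set (slot_word n (slot_of n v a))"
proof -
  have mem: "a \<in> set (high_word (kind n v) (r v) (W v))"
    if "a \<notin> set (low_word (kind n v) (r v) (W v))"
    using tree_word_parts(4)[OF v, of n] a that by blast
  then have "kind n v \<noteq> Bullet" if "a \<notin> set (low_word (kind n v) (r v) (W v))"
    using that by auto
  with mem show "slot_of n v a \<in> set (slots n)" "(v, a) \<in> set (slot_word n (slot_of n v a))"
    using set_slots[OF n] v by (auto simp: slot_of_def slot_word_def)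
qed

lemma Field_grafting:
  "Field (grafting Q T r) = {(v, a). v \<in> Field Q \<and> a \<in> Field (T v)}"
proof -
  have "(v, a) \<in> Field (grafting Q T r)" if v: "v \<in> Field Q" and a: "a \<in> Field (T v)" for v a
  proof -
    have "(a, a) \<in> T v"
      using rooted_basics(1)[OF rooted[OF v] admissible[OF v]] a
      by (auto simp: order_on_defs dest: refl_onD)
    then have "((v, a), (v, a)) \<in> grafting Q T r" using v by (simp add: grafting_def)
    then show ?thesis by (rule FieldI1)
  qed
  moreover have "v \<in> Field Q \<and> a \<in> Field (T v)" if "(v, a) \<in> Field (grafting Q T r)" for v a
  proof -
    obtain c d where "((v, a), (c, d)) \<in> grafting Q T r \<or> ((c, d), (v, a)) \<in> grafting Q T r"
      using \<open>(v, a) \<in> Field (grafting Q T r)\<close> unfolding Field_def by fast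
    then show ?thesis unfolding grafting_def by (auto intro: FieldI1 FieldI2)
  qed
  ultimately show ?thesis by auto
qed

lemma set_word:
  assumes n: "n \<in> set ns"
  shows "set (word n) = Field (grafting Q T r)"
proof -
  have "(v, a) \<in> set (word n) \<longleftrightarrow> v \<in> Field Q \<and> a \<in> Field (T v)" for v a
  proof
    assume "(v, a) \<in> set (word n)"
    then obtain s where "s \<in> set (slots n)" "(v, a) \<in> set (slot_word n s)"
      by (auto simp: word_def)
    then show "v \<in> Field Q \<and> a \<in> Field (T v)"
      using set_slots[OF n] by (auto simp: slot_word_def tree_word_parts(4)[of _ n, symmetric])
  next
    assume "v \<in> Field Q \<and> a \<in> Field (T v)"
    then show "(v, a) \<in> set (word n)"
      using slot_of_mem[OF n, of v a] unfolding word_def by auto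
  qed
  then show ?thesis unfolding Field_grafting by auto
qed

lemma word_order_iff:
  assumes n: "n \<in> set ns" and "v \<in> Field Q" "a \<in> Field (T v)" "v' \<in> Field Q" "b \<in> Field (T v')"
  shows "((v, a), (v', b)) \<in> word_order (word n) \<longleftrightarrow>
    key n (slot_of n v a) < key n (slot_of n v' b) \<or>
    slot_of n v a = slot_of n v' b \<and> ((v, a), (v', b)) \<in> word_order (slot_word n (slot_of n v a))"
  unfolding word_def
  using sorted[OF n] distinct_word[OF n, unfolded word_def] slot_of_mem[OF n] assms
  by (intro word_order_concat) auto

lemma word_order_same_tree:
  assumes n: "n \<in> set ns" and v: "v \<in> Field Q" and a: "a \<in> Field (T v)" and b: "b \<in> Field (T v)"
  shows "((v, a), (v, b)) \<in> word_order (word n) \<longleftrightarrow>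
    (a, b) \<in> word_order (tree_word (kind n v) (r v) (W v))"
proof -
  define lw hw where "lw = low_word (kind n v) (r v) (W v)" and "hw = high_word (kind n v) (r v) (W v)"
  have parts: "set lw \<inter> set hw = {}" "set lw \<union> set hw = Field (T v)"
    unfolding lw_def hw_def using tree_word_parts(3,4)[OF v] by blast+
  have less: "key n (Low v) < key n (High v)" if "c \<in> set hw" for c
    using key_less[OF n v] that unfolding hw_def by (cases "kind n v") auto
  have less': "\<not> key n (High v) < key n (Low v)" if "c \<in> set hw" for c
    using less[OF that] by simp
  have words: "slot_word n (Low v) = map (Pair v) lw" "slot_word n (High v) = map (Pair v) hw"
    by (simp_all add: slot_word_def lw_def hw_def)
  have slot: "slot_of n v c = (if c \<in> set lw then Low v else High v)" for c
    by (simp add: slot_of_def lw_def)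
  consider "a \<in> set lw" "b \<in> set lw" | "a \<in> set lw" "b \<in> set hw" | "a \<in> set hw" "b \<in> set lw"
    | "a \<in> set hw" "b \<in> set hw" using a b parts(2) by blast
  moreover have "(a, b) \<notin> word_order lw" if "a \<notin> set lw \<or> b \<notin> set lw"
    using that word_order_in_set[of a b lw] by blast
  moreover have "(a, b) \<notin> word_order hw" if "a \<notin> set hw \<or> b \<notin> set hw"
    using that word_order_in_set[of a b hw] by blast
  moreover have "c \<notin> set hw" if "c \<in> set lw" for c using parts(1) that by blast
  moreover have "c \<notin> set lw" if "c \<in> set hw" for c using parts(1) that by blast
  ultimately show ?thesis
    unfolding word_order_iff[OF n v a v b] slot tree_word_def
      lw_def[symmetric] hw_def[symmetric] word_order_append
    using less less' by cases (simp_all add: words word_order_map_Pair)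
qed

lemma key_slot_of_bounds:
  assumes n: "n \<in> set ns" and v: "v \<in> Field Q"
  shows "key n (Low v) \<le> key n (slot_of n v a)" "key n (slot_of n v a) \<le> key n (High v)"
proof -
  have "key n (Low v) \<le> key n (High v)"
    using key_Bullet[OF n v] key_less[OF n v] by (cases "kind n v = Bullet") (simp_all add: less_imp_le)
  then show "key n (Low v) \<le> key n (slot_of n v a)" "key n (slot_of n v a) \<le> key n (High v)"
    by (simp_all add: slot_of_def)
qed

lemma word_order_separated:
  assumes n: "n \<in> set ns" and v: "v \<in> Field Q" "a \<in> Field (T v)" and v': "v' \<in> Field Q" "b \<in> Field (T v')"
    and less: "key n (slot_of n v a) < key n (slot_of n v' b)"
  shows "((v, a), (v', b)) \<in> word_order (word n)" "((v', b), (v, a)) \<notin> word_order (word n)"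
  using less unfolding word_order_iff[OF n v v'] word_order_iff[OF n v' v] by auto

text \<open>If the relation holds in the grafting, then \<open>a\<close> lies in the slot of its root or before it, \<open>b\<close> in
  the slot of its root or after it, and \<open>root_less\<close> applies in every word. Otherwise one of
  \<open>separated\<close>, \<open>Minus_encloses\<close> and \<open>Plus_encloses\<close> provides a word in which \<open>b\<close> precedes
  \<open>a\<close>.\<close>

lemma word_order_other_tree:
  assumes vv': "v \<noteq> v'" and v: "v \<in> Field Q" "a \<in> Field (T v)" and v': "v' \<in> Field Q" "b \<in> Field (T v')"
  shows "(\<forall>n\<in>set ns. ((v, a), (v', b)) \<in> word_order (word n)) \<longleftrightarrow>
    (v, v') \<in> Q \<and> (a, r v) \<in> T v \<and> (r v', b) \<in> T v'"
proof
  assume rel: "(v, v') \<in> Q \<and> (a, r v) \<in> T v \<and> (r v', b) \<in> T v'"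
  show "\<forall>n\<in>set ns. ((v, a), (v', b)) \<in> word_order (word n)"
  proof
    fix n assume n: "n \<in> set ns"
    have "key n (slot_of n v a) \<le> key n (if kind n v = Plus then High v else Low v)"
    proof (cases "kind n v")
      case Minus
      have "a \<in> set (low_word Minus (r v) (W v))"
        using rel below_root_iff[OF rooted[OF v(1)] admissible[OF v(1)] v(2)] by blast
      then show ?thesis using Minus by (simp add: slot_of_def)
    qed (use key_slot_of_bounds[OF n v(1)] key_Bullet[OF n v(1)] in auto)
    also have "\<dots> < key n (if kind n v' = Plus then High v' else Low v')"
      using root_less[OF n _ vv'] rel by blast
    also have "\<dots> \<le> key n (slot_of n v' b)"
    proof (cases "kind n v'")
      case Plus
      have "b \<notin> set (low_word Plus (r v') (W v'))"
        using rel above_root_iff[OF rooted[OF v'(1)] admissible[OF v'(1)] v'(2)] by blast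
      then show ?thesis using Plus by (simp add: slot_of_def)
    qed (use key_slot_of_bounds[OF n v'(1)] key_Bullet[OF n v'(1)] in auto)
    finally show "((v, a), (v', b)) \<in> word_order (word n)"
      by (rule word_order_separated(1)[OF n v v'])
  qed
next
  assume all: "\<forall>n\<in>set ns. ((v, a), (v', b)) \<in> word_order (word n)"
  have le: "key n (slot_of n v a) \<le> key n (slot_of n v' b)" if "n \<in> set ns" for n
    using all word_order_separated(2)[OF that v' v] that by (meson not_le)
  have Q: "(v, v') \<in> Q"
  proof (rule ccontr)
    assume "(v, v') \<notin> Q"
    then obtain n where n: "n \<in> set ns" "key n (High v') < key n (Low v)"
      using separated[OF v'(1) v(1)] by blast
    then show False
      using le[OF n(1)] key_slot_of_bounds(2)[OF n(1) v'(1), of b]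
        key_slot_of_bounds(1)[OF n(1) v(1), of a] by simp
  qed
  moreover have "(a, r v) \<in> T v"
  proof -
    obtain n where n: "n \<in> set ns" "kind n v = Minus" using all_kinds[OF v(1)] by blast
    have "key n (slot_of n v a) < key n (High v)"
      using le[OF n(1)] key_slot_of_bounds(2)[OF n(1) v'(1), of b] Minus_encloses[OF n(1) Q vv' n(2)]
      by simp
    then have "a \<in> set (low_word Minus (r v) (W v))"
      using n(2) by (auto simp: slot_of_def split: if_splits)
    then show ?thesis
      using below_root_iff[OF rooted[OF v(1)] admissible[OF v(1)] v(2)] by blast
  qed
  moreover have "(r v', b) \<in> T v'"
  proof -
    obtain n where n: "n \<in> set ns" "kind n v' = Plus" using all_kinds[OF v'(1)] by blast
    have "key n (Low v') < key n (slot_of n v' b)"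
      using le[OF n(1)] key_slot_of_bounds(1)[OF n(1) v(1), of a] Plus_encloses[OF n(1) Q vv' n(2)]
      by simp
    then have "b \<notin> set (low_word Plus (r v') (W v'))"
      using n(2) by (auto simp: slot_of_def split: if_splits)
    then show ?thesis
      using above_root_iff[OF rooted[OF v'(1)] admissible[OF v'(1)] v'(2)] by blast
  qed
  ultimately show "(v, v') \<in> Q \<and> (a, r v) \<in> T v \<and> (r v', b) \<in> T v'" by blast
qed

lemma grafting_realizer: "realizer (grafting Q T r) (map word ns)"
proof (rule realizerI)
  fix L assume "L \<in> set (map word ns)"
  then show "distinct L \<and> set L = Field (grafting Q T r)"
    using distinct_word set_word by auto
next
  fix x y assume "x \<in> Field (grafting Q T r)" "y \<in> Field (grafting Q T r)"
  then obtain v a v' b where xy: "x = (v, a)" "y = (v', b)"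
    and v: "v \<in> Field Q" "a \<in> Field (T v)" and v': "v' \<in> Field Q" "b \<in> Field (T v')"
    unfolding Field_grafting by blast
  show "(x, y) \<in> grafting Q T r \<longleftrightarrow> (\<forall>L\<in>set (map word ns). (x, y) \<in> word_order L)"
  proof (cases "v = v'")
    case True
    have "(a, b) \<in> T v \<longleftrightarrow> (\<forall>\<kappa>. (a, b) \<in> word_order (tree_word \<kappa> (r v) (W v)))"
      using tree_words_realize[OF rooted[OF v(1)] admissible[OF v(1)]] v v' True by blast
    also have "\<dots> \<longleftrightarrow> (\<forall>n\<in>set ns. (a, b) \<in> word_order (tree_word (kind n v) (r v) (W v)))"
      using all_kinds[OF v(1)] by metis
    also have "\<dots> \<longleftrightarrow> (\<forall>n\<in>set ns. ((v, a), (v, b)) \<in> word_order (word n))"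
      using word_order_same_tree[OF _ v(1)] v v' True by blast
    finally show ?thesis using v(1) True xy by (simp add: grafting_def)
  next
    case False
    then show ?thesis
      using word_order_other_tree[OF False v v'] xy by (simp add: grafting_def)
  qed
qed

end

section \<open>The order of the cycle poset\<close>

text \<open>The strict order of the cycle poset in closed form. Indices outside the ground set are not excluded,
  so it is transitive only through vertices of the ground set.\<close>

fun below :: "cycle_elem \<Rightarrow> cycle_elem \<Rightarrow> bool" where
  "below (X a) (Y p j) \<longleftrightarrow> a = cyc (p div 2 + 1)"
| "below (Y p i) (Y q j) \<longleftrightarrow> p = q \<and> i < j"
| "below (Y p j) (Z b) \<longleftrightarrow> b = cyc ((p + 1) div 2)"
| "below (X a) (Z b) \<longleftrightarrow> (\<exists>p\<in>{1..6}. a = cyc (p div 2 + 1) \<and> b = cyc ((p + 1) div 2))"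
| "below _ _ \<longleftrightarrow> False"

lemma cyc_range: "cyc i \<in> {1..3}"
  using mod_less_divisor[of 3 "i - 1"] unfolding cyc_def atLeastAtMost_iff by linarith

lemma cycle_chain_nth:
  assumes "i < length (cycle_chain k p)"
  shows "cycle_chain k p ! i =
    (if i = 0 then X (cyc (p div 2 + 1)) else if i \<le> k p then Y p i else Z (cyc ((p + 1) div 2)))"
proof (cases i)
  case (Suc j)
  then show ?thesis using assms by (auto simp: cycle_chain_def nth_append simp del: upt_Suc)
qed (simp add: cycle_chain_def)

lemma length_cycle_chain: "length (cycle_chain k p) = k p + 2"
  by (simp add: cycle_chain_def)

lemma cycle_covers_below:
  assumes "(u, v) \<in> cycle_covers k"
  shows "u \<in> cycle_carrier k \<and> v \<in> cycle_carrier k \<and> below u v"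
proof -
  obtain p i where p: "p \<in> {1..6}" and i: "Suc i < length (cycle_chain k p)"
    and uv: "u = cycle_chain k p ! i" "v = cycle_chain k p ! Suc i"
    using assms unfolding cycle_covers_def by blast
  have "i < length (cycle_chain k p)" using i by simp
  note uv' = uv[unfolded cycle_chain_nth[OF this] cycle_chain_nth[OF i]]
  have "i \<le> k p" using i by (simp add: length_cycle_chain)
  then show ?thesis
    using p cyc_range[of "p div 2 + 1"] cyc_range[of "(p + 1) div 2"] unfolding uv'
    by (auto simp: cycle_carrier_def)
qed

lemma cycle_chain_in_rtrancl:
  assumes p: "p \<in> {1..6}"
  shows "i \<le> j \<Longrightarrow> j < length (cycle_chain k p) \<Longrightarrow>
    (cycle_chain k p ! i, cycle_chain k p ! j) \<in> (cycle_covers k)\<^sup>*"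
proof (induction j rule: dec_induct)
  case (step j)
  have "(cycle_chain k p ! j, cycle_chain k p ! Suc j) \<in> cycle_covers k"
    using p step.prems unfolding cycle_covers_def by blast
  moreover have "(cycle_chain k p ! i, cycle_chain k p ! j) \<in> (cycle_covers k)\<^sup>*"
    using step.prems by (intro step.IH) simp
  ultimately show ?case by (simp add: rtrancl.rtrancl_into_rtrancl)
qed simp

lemma below_trans:
  assumes "below u v" "below v w" "v \<in> cycle_carrier k"
  shows "below u w"
  using assms by (cases u; cases v; cases w) (auto simp: cycle_carrier_def)

text \<open>Only vertices of type \<open>Y\<close> have both something above and something below them, and such a vertex
  determines its chain; so composing covers never leads from one chain to another.\<close>

lemma cycle_poset_iff:
  "(u, v) \<in> cycle_poset k \<longleftrightarrow>
    u \<in> cycle_carrier k \<and> v \<in> cycle_carrier k \<and> (u = v \<or> below u v)"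
proof -
  have "u = v \<or> below u v" if "(u, v) \<in> (cycle_covers k)\<^sup>*"
    using that
  proof (induction rule: rtrancl_induct)
    case (step y z)
    have "y \<in> cycle_carrier k" "below y z" using cycle_covers_below[OF step.hyps(2)] by simp_all
    then show ?case using step.IH below_trans by blast
  qed simp
  moreover have "(u, v) \<in> (cycle_covers k)\<^sup>*"
    if "below u v" "u \<in> cycle_carrier k" "v \<in> cycle_carrier k"
  proof -
    have chain: "(u, v) \<in> (cycle_covers k)\<^sup>*"
      if "p \<in> {1..6}" "i \<le> j" "j \<le> k p + 1" "u = cycle_chain k p ! i" "v = cycle_chain k p ! j"
      for p i j
      using cycle_chain_in_rtrancl[OF that(1,2), of k] that(3-5) by (simp add: length_cycle_chain)
    note nth = cycle_chain_nth length_cycle_chain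
    show ?thesis
    proof (cases u)
      case u: (X a)
      show ?thesis
      proof (cases v)
        case v: (Y p j)
        then have "p \<in> {1..6}" "1 \<le> j" "j \<le> k p" "a = cyc (p div 2 + 1)"
          using \<open>v \<in> cycle_carrier k\<close> \<open>below u v\<close> u by (auto simp: cycle_carrier_def)
        then show ?thesis using u v by (intro chain[of p 0 j]) (simp_all add: nth)
      next
        case v: (Z b)
        then obtain p where "p \<in> {1..6}" "a = cyc (p div 2 + 1)" "b = cyc ((p + 1) div 2)"
          using \<open>below u v\<close> u by auto
        then show ?thesis using u v by (intro chain[of p 0 "k p + 1"]) (simp_all add: nth)
      qed (use \<open>below u v\<close> u in simp)
    next
      case u: (Y p i)
      then have p: "p \<in> {1..6}" "1 \<le> i" "i \<le> k p"
        using \<open>u \<in> cycle_carrier k\<close> by (auto simp: cycle_carrier_def)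
      show ?thesis
      proof (cases v)
        case v: (Y q j)
        then have "q = p" "i < j" "j \<le> k p"
          using \<open>v \<in> cycle_carrier k\<close> \<open>below u v\<close> u by (auto simp: cycle_carrier_def)
        then show ?thesis using u v p by (intro chain[of p i j]) (simp_all add: nth)
      next
        case v: (Z b)
        then have "b = cyc ((p + 1) div 2)" using \<open>below u v\<close> u by simp
        then show ?thesis using u v p by (intro chain[of p i "k p + 1"]) (simp_all add: nth)
      qed (use \<open>below u v\<close> u in simp)
    qed (use \<open>below u v\<close> in simp)
  qed
  ultimately show ?thesis unfolding cycle_poset_def by blast
qed

lemma below_irrefl: "\<not> below u u"
  by (cases u) simp_all

lemma Partial_order_cycle_poset: "Partial_order (cycle_poset k)"
proof -
  have "refl_on (cycle_carrier k) (cycle_poset k)" "trans (cycle_poset k)"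
    using below_trans by (auto simp: refl_on_def trans_def cycle_poset_iff)
  moreover have "antisym (cycle_poset k)"
    using below_trans below_irrefl unfolding antisym_def cycle_poset_iff by blast
  moreover have "cycle_poset k \<subseteq> cycle_carrier k \<times> cycle_carrier k"
    by (auto simp: cycle_poset_iff)
  ultimately show ?thesis by (simp add: order_on_defs Field_cycle_poset)
qed

section \<open>The layout of the three words\<close>

text \<open>The list \<open>slot_table v\<close> has one entry for each of the three words: the kind of \<open>v\<close> there, and the
  numbers of the blocks with its low and its high slot, where each word is cut into consecutive
  numbered blocks. All vertices \<open>Y p j\<close> with the same \<open>p\<close> share their blocks. The rows are read off
  from the three words.\<close>

definition slot_table :: "cycle_elem \<Rightarrow> (kind \<times> int \<times> int) list" where
  "slot_table v = (case v of
     X i \<Rightarrow>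
       [[(Minus, 4, 21), (Bullet, 13, 13), (Plus, 2, 3)],
        [(Plus, 2, 6), (Bullet, 3, 3), (Minus, 13, 20)],
        [(Minus, 13, 20), (Plus, 5, 6), (Bullet, 5, 5)]] ! (i - 1)
   | Z i \<Rightarrow>
       [[(Plus, 1, 8), (Bullet, 17, 17), (Minus, 18, 19)],
        [(Minus, 15, 16), (Plus, 1, 8), (Bullet, 16, 16)],
        [(Bullet, 18, 18), (Minus, 15, 19), (Plus, 1, 8)]] ! (i - 1)
   | Y p j \<Rightarrow>
       [[(Plus, 3, 5), (Minus, 16, 18), (Bullet, 10, 10)],
        [(Minus, 7, 9), (Bullet, 10, 10), (Plus, 12, 14)],
        [(Bullet, 11, 11), (Plus, 2, 4), (Minus, 15, 17)],
        [(Plus, 12, 14), (Minus, 7, 9), (Bullet, 11, 11)],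
        [(Minus, 17, 19), (Bullet, 11, 11), (Plus, 4, 6)],
        [(Bullet, 10, 10), (Plus, 12, 14), (Minus, 7, 9)]] ! (p - 1))"

definition kind_in :: "nat \<Rightarrow> cycle_elem \<Rightarrow> kind" where
  "kind_in n v = fst (slot_table v ! n)"

definition height :: "cycle_elem \<Rightarrow> int" where
  "height v = (case v of Y p j \<Rightarrow> int j | _ \<Rightarrow> 0)"

text \<open>Within a shared block, the slots are ordered by \<open>j\<close>, increasingly or decreasingly: the nested
  words of kinds \<open>Plus\<close> and \<open>Minus\<close> run through the chain downwards on one side of the argument of
  \<open>A_word\<close> or \<open>B_word\<close> and upwards on the other. Pairs are compared lexicographically.\<close>

fun slot_key :: "nat \<Rightarrow> cycle_elem slot \<Rightarrow> int \<times> int" where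
  "slot_key n (Low v) =
    (fst (snd (slot_table v ! n)), if kind_in n v = Plus then - height v else height v)"
| "slot_key n (High v) =
    (snd (snd (slot_table v ! n)), if kind_in n v = Minus then - height v else height v)"

context
  fixes k :: "nat \<Rightarrow> nat"
begin

definition chain_up :: "(cycle_elem \<Rightarrow> cycle_elem slot) \<Rightarrow> nat \<Rightarrow> cycle_elem slot list" where
  "chain_up s p = map (\<lambda>j. s (Y p j)) [1..<Suc (k p)]"

definition chain_down :: "(cycle_elem \<Rightarrow> cycle_elem slot) \<Rightarrow> nat \<Rightarrow> cycle_elem slot list" where
  "chain_down s p = rev (chain_up s p)"

text \<open>The three words with each part of a tree word replaced by its slot.\<close>

definition cycle_slots :: "nat \<Rightarrow> cycle_elem slot list" where
  "cycle_slots n =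
    [[Low (Z 1), Low (X 2)] @ chain_down Low 1 @ [Low (X 1)] @ chain_up High 1 @ [High (X 2)] @
       chain_up Low 2 @ [High (Z 1)] @ chain_down High 2 @ chain_up Low 6 @ chain_up Low 3 @
       chain_down Low 4 @ [Low (X 3)] @ chain_up High 4 @ [Low (Z 2), High (Z 2)] @
       chain_up Low 5 @ [Low (Z 3)] @ chain_down High 5 @ [High (X 3), High (X 1)],
     [Low (Z 2)] @ chain_down Low 3 @ [Low (X 2)] @ chain_up High 3 @ [Low (X 3), High (X 3)] @
       chain_up Low 4 @ [High (Z 2)] @ chain_down High 4 @ chain_up Low 2 @ chain_up Low 5 @
       chain_down Low 6 @ [Low (X 1)] @ chain_up High 6 @ [Low (Z 3)] @
       chain_up Low 1 @ [Low (Z 1)] @ chain_down High 1 @ [High (Z 3)],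
     [Low (Z 3), Low (X 1), High (X 1)] @ chain_down Low 5 @ [Low (X 3)] @ chain_up High 5 @
       chain_up Low 6 @ [High (Z 3)] @ chain_down High 6 @ chain_up Low 1 @ chain_up Low 4 @
       chain_down Low 2 @ [Low (X 2)] @ chain_up High 2 @
       chain_up Low 3 @ [Low (Z 2)] @ chain_down High 3 @ [Low (Z 1), High (Z 1), High (X 2)]] ! n"

end

lemma numeral_ranges: "{1..3::nat} = {1, 2, 3}" "{1..6::nat} = {1, 2, 3, 4, 5, 6}"
  by (simp_all add: numeral_eq_Suc atLeastAtMostSuc_conv insert_commute)

lemma cycle_carrier_cases:
  assumes "v \<in> cycle_carrier k"
  obtains "v = X 1" | "v = X 2" | "v = X 3" | "v = Z 1" | "v = Z 2" | "v = Z 3"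
  | j where "v = Y 1 j" "1 \<le> j" "j \<le> k 1" | j where "v = Y 2 j" "1 \<le> j" "j \<le> k 2"
  | j where "v = Y 3 j" "1 \<le> j" "j \<le> k 3" | j where "v = Y 4 j" "1 \<le> j" "j \<le> k 4"
  | j where "v = Y 5 j" "1 \<le> j" "j \<le> k 5" | j where "v = Y 6 j" "1 \<le> j" "j \<le> k 6"
  using assms unfolding cycle_carrier_def numeral_ranges by auto

text \<open>The index 1 is written \<open>Suc 0\<close> because this is its normal form under simplification.\<close>

lemma slot_table_rows:
  shows "slot_table (X (Suc 0)) = [(Minus, 4, 21), (Bullet, 13, 13), (Plus, 2, 3)]"
    "slot_table (X (2)) = [(Plus, 2, 6), (Bullet, 3, 3), (Minus, 13, 20)]"
    "slot_table (X (3)) = [(Minus, 13, 20), (Plus, 5, 6), (Bullet, 5, 5)]"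
    "slot_table (Z (Suc 0)) = [(Plus, 1, 8), (Bullet, 17, 17), (Minus, 18, 19)]"
    "slot_table (Z (2)) = [(Minus, 15, 16), (Plus, 1, 8), (Bullet, 16, 16)]"
    "slot_table (Z (3)) = [(Bullet, 18, 18), (Minus, 15, 19), (Plus, 1, 8)]"
    "slot_table (Y (Suc 0) j) = [(Plus, 3, 5), (Minus, 16, 18), (Bullet, 10, 10)]"
    "slot_table (Y (2) j) = [(Minus, 7, 9), (Bullet, 10, 10), (Plus, 12, 14)]"
    "slot_table (Y (3) j) = [(Bullet, 11, 11), (Plus, 2, 4), (Minus, 15, 17)]"
    "slot_table (Y (4) j) = [(Plus, 12, 14), (Minus, 7, 9), (Bullet, 11, 11)]"
    "slot_table (Y (5) j) = [(Minus, 17, 19), (Bullet, 11, 11), (Plus, 4, 6)]"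
    "slot_table (Y (6) j) = [(Bullet, 10, 10), (Plus, 12, 14), (Minus, 7, 9)]"
  by (simp_all add: slot_table_def)

lemma height_simps: "height (X i) = 0" "height (Z i) = 0" "height (Y p j) = int j"
  by (simp_all add: height_def)

lemmas layout_simps = slot_table_rows height_simps kind_in_def

lemma cycle_slots_sorted:
  assumes "n \<in> {0, 1, 2}"
  shows "sorted_wrt (\<lambda>s t. slot_key n s < slot_key n t) (cycle_slots k n)"
  using assms
  by (auto simp: cycle_slots_def chain_down_def chain_up_def sorted_wrt_append sorted_wrt_map sorted_wrt_rev
      layout_simps simp del: upt_Suc)

lemma set_cycle_slots:
  assumes "n \<in> {0, 1, 2}"
  shows "set (cycle_slots k n) =
    Low ` cycle_carrier k \<union> High ` {v \<in> cycle_carrier k. kind_in n v \<noteq> Bullet}"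
proof (intro equalityI subsetI)
  fix s assume "s \<in> set (cycle_slots k n)"
  then show "s \<in> Low ` cycle_carrier k \<union> High ` {v \<in> cycle_carrier k. kind_in n v \<noteq> Bullet}"
    using assms
    by (auto simp: cycle_slots_def chain_down_def chain_up_def cycle_carrier_def layout_simps simp del: upt_Suc)
next
  have low: "Low v \<in> set (cycle_slots k n)" if "v \<in> cycle_carrier k" for v
    using that assms
    by (elim cycle_carrier_cases) (auto simp: cycle_slots_def chain_down_def chain_up_def simp del: upt_Suc)
  have high: "High v \<in> set (cycle_slots k n)" if "v \<in> cycle_carrier k" "kind_in n v \<noteq> Bullet" for v
    using that assms
    by (elim cycle_carrier_cases)
       (auto simp: cycle_slots_def chain_down_def chain_up_def layout_simps simp del: upt_Suc)
  fix s
  assume "s \<in> Low ` cycle_carrier k \<union> High ` {v \<in> cycle_carrier k. kind_in n v \<noteq> Bullet}"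
  then show "s \<in> set (cycle_slots k n)" using low high by blast
qed

lemma slot_keys:
  assumes "n \<in> {0, 1, 2}" "v \<in> cycle_carrier k"
  shows "if kind_in n v = Bullet then slot_key n (High v) = slot_key n (Low v)
    else slot_key n (Low v) < slot_key n (High v)"
  using assms by (elim cycle_carrier_cases) (auto simp: layout_simps)

lemma cycle_all_kinds:
  assumes "v \<in> cycle_carrier k"
  shows "\<exists>n\<in>{0, 1, 2}. kind_in n v = \<kappa>"
  using assms by (elim cycle_carrier_cases; cases \<kappa>) (simp_all add: layout_simps)

lemma below_X_Z:
  "below (X a) (Z b) \<longleftrightarrow>
    a = 1 \<and> b = 1 \<or> a = 2 \<and> b = 1 \<or> a = 2 \<and> b = 2 \<or> a = 3 \<and> b = 2 \<or> a = 3 \<and> b = 3 \<or>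
    a = 1 \<and> b = 3"
  unfolding below.simps numeral_ranges by (auto simp: cyc_def)

text \<open>A comparison of table rows for each pair of the twelve types of vertices; the same holds for
  \<open>cycle_nested\<close>, which collects the other three conditions of the layout.\<close>

lemma cycle_separated:
  assumes "v \<in> cycle_carrier k" "v' \<in> cycle_carrier k" "v' \<noteq> v" "\<not> below v' v"
  shows "\<exists>n\<in>{0, 1, 2}. slot_key n (High v) < slot_key n (Low v')"
  using assms
  by (elim cycle_carrier_cases) (simp_all add: layout_simps cyc_def below_X_Z del: below.simps(4))

lemma cycle_nested:
  assumes "n \<in> {0, 1, 2}" "v \<in> cycle_carrier k" "v' \<in> cycle_carrier k" "below v v'"
  shows "slot_key n (if kind_in n v = Plus then High v else Low v) <
      slot_key n (if kind_in n v' = Plus then High v' else Low v') \<and>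
    (kind_in n v = Minus \<longrightarrow> slot_key n (High v') < slot_key n (High v)) \<and>
    (kind_in n v' = Plus \<longrightarrow> slot_key n (Low v') < slot_key n (Low v))"
proof -
  consider "n = 0" | "n = 1" | "n = 2" using assms(1) by blast
  then show ?thesis
  proof cases
    case 1
    show ?thesis using assms(2-4) unfolding 1
      by (elim cycle_carrier_cases) (simp_all add: layout_simps cyc_def below_X_Z del: below.simps(4))
  next
    case 2
    show ?thesis using assms(2-4) unfolding 2
      by (elim cycle_carrier_cases) (simp_all add: layout_simps cyc_def below_X_Z del: below.simps(4))
  next
    case 3
    show ?thesis using assms(2-4) unfolding 3
      by (elim cycle_carrier_cases) (simp_all add: layout_simps cyc_def below_X_Z del: below.simps(4))
  qed
qed


section \<open>The realizer\<close>

theorem proposition9p2: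
  fixes k :: "nat \<Rightarrow> nat"
    and T :: "cycle_elem \<Rightarrow> 'a rel" and r :: "cycle_elem \<Rightarrow> 'a"
    and W :: "cycle_elem \<Rightarrow> 'a tree_words"
    and P :: "(cycle_elem \<times> 'a) rel"
    and \<rho> :: "cycle_elem \<Rightarrow> cycle_elem \<times> 'a"
    and W' :: "cycle_elem \<Rightarrow> (cycle_elem \<times> 'a) tree_words"
  assumes "\<forall>v\<in>Field (cycle_poset k). rooted_tree_poset (T v) (r v)"
    and "\<forall>v\<in>Field (cycle_poset k). admissible_words (T v) (r v) (W v)"
    and "P = grafting (cycle_poset k) T r"
    and "\<rho> = (\<lambda>v. (v, r v))"
    and "W' = (\<lambda>v. map_tree_words (Pair v) (W v))"
  shows "realizer P [order1 k \<rho> W', order2 k \<rho> W', order3 k \<rho> W']"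
proof -
  interpret slot_layout "cycle_poset k" T r W "[0, 1, 2]" kind_in "cycle_slots k" slot_key
  proof
    show "Partial_order (cycle_poset k)" by (rule Partial_order_cycle_poset)
  next
    fix v assume "v \<in> Field (cycle_poset k)"
    then show "rooted_tree_poset (T v) (r v)" "admissible_words (T v) (r v) (W v)"
      using assms(1,2) by blast+
  next
    fix n :: nat assume "n \<in> set [0, 1, 2]"
    then have n: "n \<in> {0, 1, 2}" by simp
    show "sorted_wrt (\<lambda>s t. slot_key n s < slot_key n t) (cycle_slots k n)"
      by (rule cycle_slots_sorted[OF n])
    show "set (cycle_slots k n) = Low ` Field (cycle_poset k) \<union>
        High ` {v \<in> Field (cycle_poset k). kind_in n v \<noteq> Bullet}"
      unfolding Field_cycle_poset by (rule set_cycle_slots[OF n])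
    fix v
    {
      assume "v \<in> Field (cycle_poset k)"
      then have v: "v \<in> cycle_carrier k" by (simp add: Field_cycle_poset)
      show "slot_key n (High v) = slot_key n (Low v)" if "kind_in n v = Bullet"
        using slot_keys[OF n v] that by simp
      show "slot_key n (Low v) < slot_key n (High v)" if "kind_in n v \<noteq> Bullet"
        using slot_keys[OF n v] that by simp
    }
    fix v' assume "(v, v') \<in> cycle_poset k" "v \<noteq> v'"
    then have "v \<in> cycle_carrier k" "v' \<in> cycle_carrier k" "below v v'"
      by (auto simp: cycle_poset_iff)
    note nested = cycle_nested[OF n this]
    show "slot_key n (if kind_in n v = Plus then High v else Low v) <
        slot_key n (if kind_in n v' = Plus then High v' else Low v')"
      using nested by blast
    show "slot_key n (High v') < slot_key n (High v)" if "kind_in n v = Minus"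
      using nested that by blast
    show "slot_key n (Low v') < slot_key n (Low v)" if "kind_in n v' = Plus"
      using nested that by blast
  next
    fix v and \<kappa> :: kind assume "v \<in> Field (cycle_poset k)"
    then show "\<exists>n\<in>set [0, 1, 2]. kind_in n v = \<kappa>"
      using cycle_all_kinds[of v k \<kappa>] by (simp add: Field_cycle_poset)
  next
    fix v v'
    assume v: "v \<in> Field (cycle_poset k)" "v' \<in> Field (cycle_poset k)" "(v', v) \<notin> cycle_poset k"
    then have "v' \<noteq> v" "\<not> below v' v" by (auto simp: Field_cycle_poset cycle_poset_iff)
    then show "\<exists>n\<in>set [0, 1, 2]. slot_key n (High v) < slot_key n (Low v')"
      using cycle_separated[of v k v'] v by (simp add: Field_cycle_poset)
  qed
  note word_defs = word_def slot_word_def cycle_slots_def chain_up_def chain_down_def prod_up_def prod_down_def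
    A_word_def B_word_def C_word_def I_minus_def I_plus_def V_plus_def V_minus_def V_bullet_def
    assms(4,5) layout_simps tree_words.map_sel
  have "word 0 = order1 k \<rho> W'"
    by (simp add: word_defs order1_def comp_def rev_map map_concat del: upt_Suc)
  moreover have "word 1 = order2 k \<rho> W'"
    by (simp add: word_defs order2_def comp_def rev_map map_concat del: upt_Suc)
  moreover have "word 2 = order3 k \<rho> W'"
    by (simp add: word_defs order3_def comp_def rev_map map_concat del: upt_Suc)
  ultimately show ?thesis
    using grafting_realizer unfolding assms(3) by simp
qed

end
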